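(* Assume (H1) and (H2), and that $f$ is continuous at the point $x\in\mathbb{R}^d$. Then the sequence $\big(f_n(x)-f(x)\big)_{n\ge1}$ satisfies an LDP with speed $\big(\sum_{i=1}^n h_i^d\big)$ and rate function $I_x$.
   Context: Let $X_1,X_2,\dots$ be i.i.d. $\mathbb{R}^d$-valued random vectors with bounded probability density $f$, let $(h_n)$ be a positive bandwidth sequence and $K:\mathbb{R}^d\to\mathbb{R}$ a kernel. The recursive kernel density estimator is $f_n(x)=\frac1n\sum_{i=1}^n h_i^{-d}K\big((x-X_i)/h_i\big)$. (H1): $K$ is bounded and integrable, $\int_{\mathbb{R}^d}K(z)dz=1$, and $K(z)\to0$ as $\|z\|\to\infty$. (H2): $h_n=cn^{-a}$ with $c>0$ and $0<a<1/d$. Rate function: with $a$ from (H2), $\psi(u)=\int_{[0,1]\times\mathbb{R}^d}s^{-ad}\big(e^{s^{ad}\frac{u}{1-ad}K(z)}-1\big)ds\,dz$ and $I(t)=\sup_{u\in\mathbb{R}}\{ut-\psi(u)\}$. If $f(x)\neq0$, $I_x(t)=f(x)(1-ad)\,I\Big(\frac{1}{1-ad}+\frac{t}{f(x)(1-ad)}\Big)$; if $f(x)=0$, $I_x(0)=0$ and $I_x(t)=+\infty$ for $t\ne0$. A sequence $(Z_n)$ of real random variables satisfies an LDP with speed $(\nu_n)$ (positive, nondecreasing, $\nu_n\to\infty$) and good rate function $J:\mathbb{R}\to[0,\infty]$ (compact level sets) if for every Borel set $B$: $-\inf_{\mathrm{int}B}J\le\liminf_n\nu_n^{-1}\log\mathbb{P}[Z_n\in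 B]\le\limsup_n\nu_n^{-1}\log\mathbb{P}[Z_n\in B]\le-\inf_{\overline B}J$. *)

theory Defs
  imports "HOL-Probability.Probability"
begin

definition rec_kde ::
  "(nat \<Rightarrow> real) \<Rightarrow> ('a::euclidean_space \<Rightarrow> real) \<Rightarrow> (nat \<Rightarrow> 'b \<Rightarrow> 'a) \<Rightarrow> nat \<Rightarrow> 'a \<Rightarrow> 'b \<Rightarrow> real"
  where "rec_kde h K X n x \<omega> =
     (1 / real n) * (\<Sum>i=1..n. h i powr (- real DIM('a)) * K ((1 / h i) *\<^sub>R (x - X i \<omega>)))"

definition kde_psi :: "real \<Rightarrow> ('a::euclidean_space \<Rightarrow> real) \<Rightarrow> real \<Rightarrow> real"
  where "kde_psi a K u =
     (LINT p:({0..1} \<times> UNIV)|(lborel :: (real \<times> 'a) measure).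
        (fst p) powr (- (a * real DIM('a))) *
        (exp ((fst p) powr (a * real DIM('a)) * (u / (1 - a * real DIM('a))) * K (snd p)) - 1))"

definition kde_I :: "real \<Rightarrow> ('a::euclidean_space \<Rightarrow> real) \<Rightarrow> real \<Rightarrow> ereal"
  where "kde_I a K t = (SUP u\<in>UNIV. ereal (u * t - kde_psi a K u))"

definition kde_Ix :: "real \<Rightarrow> ('a::euclidean_space \<Rightarrow> real) \<Rightarrow> ('a \<Rightarrow> real) \<Rightarrow> 'a \<Rightarrow> real \<Rightarrow> ereal"
  where "kde_Ix a K f x t =
     (let d = real DIM('a) in
      if f x \<noteq> 0 then ereal (f x * (1 - a * d)) *
                         kde_I a K (1 / (1 - a * d) + t / (f x * (1 - a * d)))
      else (if t = 0 then 0 else \<infinity>))"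

definition good_rate_function :: "(real \<Rightarrow> ereal) \<Rightarrow> bool"
  where "good_rate_function J \<longleftrightarrow>
     (\<forall>t. J t \<ge> 0) \<and> (\<forall>\<alpha>::real. compact {t. J t \<le> ereal \<alpha>})"

definition scaled_log :: "real \<Rightarrow> real \<Rightarrow> ereal"
  where "scaled_log \<nu> p = (if p = 0 then - \<infinity> else ereal (ln p / \<nu>))"

definition LDP :: "'b measure \<Rightarrow> (nat \<Rightarrow> 'b \<Rightarrow> real) \<Rightarrow> (nat \<Rightarrow> real) \<Rightarrow> (real \<Rightarrow> ereal) \<Rightarrow> bool"
  where "LDP M Z \<nu> J \<longleftrightarrow>
     (\<forall>n\<ge>1. \<nu> n > 0) \<and> (\<forall>n\<ge>1. \<nu> n \<le> \<nu> (Suc n)) \<and> filterlim \<nu> at_top sequentially \<and>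
     good_rate_function J \<and>
     (\<forall>B \<in> sets borel.
        - (INF t\<in>interior B. J t)
          \<le> liminf (\<lambda>n. scaled_log (\<nu> n) (measure M {\<omega>\<in>space M. Z n \<omega> \<in> B})) \<and>
        limsup (\<lambda>n. scaled_log (\<nu> n) (measure M {\<omega>\<in>space M. Z n \<omega> \<in> B}))
          \<le> - (INF t\<in>closure B. J t))"

end

theory Submission
  imports Defs
begin

text \<open>
  The scaled cumulant generating function of \<open>f\<^sub>n(x) - f(x)\<close> converges to the differentiable
  function \<open>\<Lambda>(u) = f(x) (1 - ad) \<psi>(u) - u f(x)\<close>, and the Legendre transform of \<open>\<Lambda>\<close> is \<open>I\<^sub>x\<close>, so the
  one-dimensional Gaertner-Ellis theorem applies.

  Gaertner-Ellis needs no convexity here. The upper bound is Markov's inequality on a finite cover by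
  half-lines. For the lower bound, tilting by \<open>exp (\<nu>\<^sub>n u Z\<^sub>n)\<close> makes \<open>Z\<^sub>n\<close> concentrate at \<open>\<Lambda>'(u)\<close>, at cost
  \<open>u \<Lambda>'(u) - \<Lambda>(u)\<close>. If \<open>g(u) = u t - \<Lambda>(u)\<close> is bounded above, there is a \<open>u\<close> with \<open>g'(u)\<close> small and
  \<open>u g'(u) \<ge> 0\<close>; then \<open>\<Lambda>'(u) = t - g'(u)\<close> is close to \<open>t\<close> and the cost \<open>g(u) - u g'(u)\<close> is at most
  \<open>\<Lambda>\<^sup>*(t)\<close>.

  For the convergence, put \<open>b = ad\<close>, let \<open>L\<^sub>i(\<theta>)\<close> be \<open>h\<^sub>i\<close> to the power \<open>-d\<close> times the logarithm of
  \<open>E exp (\<theta> K ((x - X\<^sub>i) / h\<^sub>i))\<close> and let \<open>\<kappa>\<^sub>n\<close> be the mean of the \<open>n\<close> numbers \<open>(i/n) powr (-b)\<close>. Then the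
  scaled cumulant generating function is \<open>1/\<kappa>\<^sub>n\<close> times the mean of
  \<open>(i/n) powr (-b) * L\<^sub>i(u \<kappa>\<^sub>n (i/n) powr b)\<close>, minus \<open>u f(x)\<close>. Writing means as integrals over \<open>s \<in> (0,1]\<close>
  with \<open>i = \<lceil>n s\<rceil>\<close>, dominated convergence gives both \<open>\<kappa>\<^sub>n \<rightarrow> 1/(1 - b)\<close> and the limit, because
  \<open>L\<^sub>i(\<theta>\<^sub>i)\<close> tends to \<open>f(x) \<integral>(exp (\<theta> K z) - 1) dz\<close> whenever \<open>\<theta>\<^sub>i \<rightarrow> \<theta>\<close>.
\<close>

section \<open>The Gaertner-Ellis theorem on the real line\<close>

text \<open>A constant prefactor contributes only \<open>ln C / \<nu> n\<close>, which vanishes as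
  the speed diverges. Hence neither the number of sets in a finite cover nor the factor 1/2 lost in
  a tilting argument affects the rate.\<close>

lemma limsup_scaled_log_le:
  assumes "filterlim \<nu> at_top sequentially" and "C > 0"
    and nonneg: "\<And>n. p n \<ge> 0"
    and le: "eventually (\<lambda>n. p n \<le> C * exp (- (\<nu> n * \<alpha>))) sequentially"
  shows "limsup (\<lambda>n. scaled_log (\<nu> n) (p n)) \<le> ereal (- \<alpha>)"
proof -
  have pos: "eventually (\<lambda>n. \<nu> n > 0) sequentially"
    using assms(1) by (simp add: filterlim_at_top_dense)
  have "eventually (\<lambda>n. scaled_log (\<nu> n) (p n) \<le> ereal (ln C / \<nu> n - \<alpha>)) sequentially"
    using le pos
  proof eventually_elim
    case (elim n)
    show ?case
    proof (cases "p n = 0")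
      case False
      hence "p n > 0" using nonneg[of n] by simp
      hence "ln (p n) \<le> ln (C * exp (- (\<nu> n * \<alpha>)))"
        using elim by simp
      also have "\<dots> = ln C - \<nu> n * \<alpha>" using \<open>C > 0\<close> by (simp add: ln_mult)
      finally have "ln (p n) / \<nu> n \<le> (ln C - \<nu> n * \<alpha>) / \<nu> n"
        using elim by (intro divide_right_mono) auto
      also have "\<dots> = ln C / \<nu> n - \<alpha>" using elim by (simp add: diff_divide_distrib)
      finally show ?thesis using False by (simp add: scaled_log_def)
    qed (simp add: scaled_log_def)
  qed
  hence "limsup (\<lambda>n. scaled_log (\<nu> n) (p n)) \<le> limsup (\<lambda>n. ereal (ln C / \<nu> n - \<alpha>))"
    by (rule Limsup_mono)
  also have "\<dots> = ereal (- \<alpha>)"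
  proof (rule lim_imp_Limsup)
    have "(\<lambda>n. ln C / \<nu> n) \<longlonglongrightarrow> 0"
      by (intro tendsto_divide_0[OF tendsto_const] filterlim_at_top_imp_at_infinity assms(1))
    from tendsto_diff[OF this tendsto_const[of \<alpha>]]
    show "(\<lambda>n. ereal (ln C / \<nu> n - \<alpha>)) \<longlonglongrightarrow> ereal (- \<alpha>)"
      by (intro tendsto_ereal) simp
  qed simp
  finally show ?thesis .
qed

lemma liminf_scaled_log_ge:
  assumes "filterlim \<nu> at_top sequentially" and "C > 0"
    and ge: "eventually (\<lambda>n. p n \<ge> C * exp (- (\<nu> n * \<alpha>))) sequentially"
  shows "liminf (\<lambda>n. scaled_log (\<nu> n) (p n)) \<ge> ereal (- \<alpha>)"
proof -
  have pos: "eventually (\<lambda>n. \<nu> n > 0) sequentially"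
    using assms(1) by (simp add: filterlim_at_top_dense)
  have "eventually (\<lambda>n. ereal (ln C / \<nu> n - \<alpha>) \<le> scaled_log (\<nu> n) (p n)) sequentially"
    using ge pos
  proof eventually_elim
    case (elim n)
    have pos': "C * exp (- (\<nu> n * \<alpha>)) > 0" using \<open>C > 0\<close> by simp
    hence p: "p n > 0" using elim by linarith
    have "ln C / \<nu> n - \<alpha> = (ln C - \<nu> n * \<alpha>) / \<nu> n"
      using elim by (simp add: diff_divide_distrib)
    also have "ln C - \<nu> n * \<alpha> = ln (C * exp (- (\<nu> n * \<alpha>)))" using \<open>C > 0\<close> by (simp add: ln_mult)
    also have "\<dots> \<le> ln (p n)" using elim pos' p by simp
    finally show ?case using elim p by (simp add: scaled_log_def divide_right_mono)
  qed
  hence "liminf (\<lambda>n. ereal (ln C / \<nu> n - \<alpha>)) \<le> liminf (\<lambda>n. scaled_log (\<nu> n) (p n))"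
    by (rule Liminf_mono)
  moreover have "liminf (\<lambda>n. ereal (ln C / \<nu> n - \<alpha>)) = ereal (- \<alpha>)"
  proof (rule lim_imp_Liminf)
    have "(\<lambda>n. ln C / \<nu> n) \<longlonglongrightarrow> 0"
      by (intro tendsto_divide_0[OF tendsto_const] filterlim_at_top_imp_at_infinity assms(1))
    from tendsto_diff[OF this tendsto_const[of \<alpha>]]
    show "(\<lambda>n. ereal (ln C / \<nu> n - \<alpha>)) \<longlonglongrightarrow> ereal (- \<alpha>)"
      by (intro tendsto_ereal) simp
  qed simp
  ultimately show ?thesis by simp
qed

section \<open>Legendre transforms as good rate functions\<close>

definition legendre :: "(real \<Rightarrow> real) \<Rightarrow> real \<Rightarrow> ereal"
  where "legendre \<Lambda> t = (SUP u\<in>UNIV. ereal (u * t - \<Lambda> u))"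

lemma legendre_upper: "ereal (u * t - \<Lambda> u) \<le> legendre \<Lambda> t"
  unfolding legendre_def by (rule SUP_upper) simp

text \<open>The slope \<open>u = 0\<close> gives nonnegativity. Sublevel sets are intersections of
  closed sets, one for each slope, and the slopes 1 and -1 alone already confine them to a bounded
  interval.\<close>

lemma good_rate_function_legendre:
  assumes "\<Lambda> 0 = 0"
  shows "good_rate_function (legendre \<Lambda>)"
  unfolding good_rate_function_def
proof (intro conjI allI)
  fix t show "legendre \<Lambda> t \<ge> 0"
    using legendre_upper[of 0 t \<Lambda>] assms by (simp add: zero_ereal_def)
next
  fix \<alpha> :: real
  have eq: "{t. legendre \<Lambda> t \<le> ereal \<alpha>} = (\<Inter>u. {t. u * t - \<Lambda> u \<le> \<alpha>})"
    unfolding legendre_def by (auto simp: SUP_le_iff)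
  have "closed (\<Inter>u. {t. u * t - \<Lambda> u \<le> \<alpha>})"
    by (intro closed_INT ballI closed_Collect_le continuous_intros)
  moreover have "(\<Inter>u. {t. u * t - \<Lambda> u \<le> \<alpha>}) \<subseteq> {- \<alpha> - \<Lambda> (-1) .. \<alpha> + \<Lambda> 1}"
  proof
    fix t assume "t \<in> (\<Inter>u. {t. u * t - \<Lambda> u \<le> \<alpha>})"
    hence "1 * t - \<Lambda> 1 \<le> \<alpha>" "(-1) * t - \<Lambda> (-1) \<le> \<alpha>" by blast+
    thus "t \<in> {- \<alpha> - \<Lambda> (-1) .. \<alpha> + \<Lambda> 1}" by auto
  qed
  ultimately show "compact {t. legendre \<Lambda> t \<le> ereal \<alpha>}"
    unfolding eq by (meson bounded_closed_interval bounded_subset compact_eq_bounded_closed)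
qed

text \<open>
  Maximising \<open>g u - \<eta> * u\<^sup>2 / 2\<close> for small \<open>\<eta>\<close> yields a point whose derivative is \<open>\<eta> * u\<close>.
\<close>
lemma bounded_above_almost_critical:
  fixes g g' :: "real \<Rightarrow> real"
  assumes deriv: "\<And>u. (g has_real_derivative g' u) (at u)"
    and bound: "\<And>u. g u \<le> B" and "\<epsilon> > 0"
  obtains u where "\<bar>g' u\<bar> < \<epsilon>" and "u * g' u \<ge> 0"
proof -
  define D where "D = B - g 0 + 1"
  have "D > 0" using bound[of 0] by (simp add: D_def)
  \<comment> \<open>Chosen so that \<open>2 * D * \<eta>\<close> equals
    \<open>\<epsilon>\<^sup>2 / 2\<close>; the slope \<open>\<eta> * \<bar>u\<bar>\<close> found
    below is less than \<open>\<eta> * R = sqrt (2 * D * \<eta>)\<close>.\<close>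
  define \<eta> where "\<eta> = \<epsilon>\<^sup>2 / (4 * D)"
  have "\<eta> > 0" using \<open>\<epsilon> > 0\<close> \<open>D > 0\<close> by (simp add: \<eta>_def)
  define k where "k u = g u - \<eta> * u\<^sup>2 / 2" for u
  have kderiv: "(k has_real_derivative g' u - \<eta> * u) (at u)" for u
    unfolding k_def by (auto intro!: derivative_eq_intros deriv)
  \<comment> \<open>At distance \<open>R\<close> or more from 0 the penalty outweighs all that
    \<open>g\<close> can gain over \<open>g 0\<close>, so the maximum of \<open>k\<close> on the
    interval is attained in its interior. The summand 1 in \<open>D\<close> makes this
    strict.\<close>
  define R where "R = sqrt (2 * D / \<eta>)"
  have "R > 0" using \<open>D > 0\<close> \<open>\<eta> > 0\<close> by (simp add: R_def)
  have outside: "\<bar>u\<bar> < R" if "k u \<ge> k 0" for u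
  proof -
    have "\<eta> * u\<^sup>2 / 2 < D" using that bound[of u] by (simp add: k_def D_def)
    hence "u\<^sup>2 < 2 * D / \<eta>" using \<open>\<eta> > 0\<close> by (simp add: field_simps)
    hence "sqrt (u\<^sup>2) < R" unfolding R_def by (rule real_sqrt_less_mono)
    thus ?thesis by simp
  qed
  have "continuous_on {-R..R} k"
    using kderiv by (meson DERIV_isCont continuous_at_imp_continuous_on)
  then obtain u where u: "u \<in> {-R..R}" and max: "\<And>v. v \<in> {-R..R} \<Longrightarrow> k v \<le> k u"
    using continuous_attains_sup[of "{-R..R}" k] \<open>R > 0\<close> by fastforce
  have "k 0 \<le> k u" using max[of 0] \<open>R > 0\<close> by simp
  hence uR: "\<bar>u\<bar> < R" by (rule outside)
  have "g' u - \<eta> * u = 0"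
  proof (rule DERIV_local_max[OF kderiv])
    show "0 < R - \<bar>u\<bar>" using uR by simp
    show "\<forall>y. \<bar>u - y\<bar> < R - \<bar>u\<bar> \<longrightarrow> k y \<le> k u"
    proof (intro allI impI max)
      fix y assume "\<bar>u - y\<bar> < R - \<bar>u\<bar>"
      thus "y \<in> {-R..R}" by (simp only: atLeastAtMost_iff) arith
    qed
  qed
  hence eq: "g' u = \<eta> * u" by simp
  have "\<bar>g' u\<bar> = \<eta> * \<bar>u\<bar>" using eq \<open>\<eta> > 0\<close> by (simp add: abs_mult)
  also have "\<dots> < \<eta> * R" using uR \<open>\<eta> > 0\<close> by simp
  also have "\<dots> = sqrt (2 * D * \<eta>)"
  proof (rule real_sqrt_unique[symmetric])
    show "(\<eta> * R)\<^sup>2 = 2 * D * \<eta>" using \<open>D > 0\<close> \<open>\<eta> > 0\<close>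
      by (simp add: R_def power_mult_distrib) (simp add: power2_eq_square)
  qed (use \<open>\<eta> > 0\<close> \<open>R > 0\<close> in simp)
  also have "\<dots> \<le> sqrt (\<epsilon>\<^sup>2)"
    using \<open>D > 0\<close> by (intro real_sqrt_le_mono) (simp add: \<eta>_def)
  also have "\<dots> = \<epsilon>" using \<open>\<epsilon> > 0\<close> by simp
  finally have "\<bar>g' u\<bar> < \<epsilon>" .
  moreover have "u * g' u \<ge> 0" using eq \<open>\<eta> > 0\<close> by (simp add: mult.left_commute)
  ultimately show thesis by (rule that)
qed

section \<open>Exponential tilting and Markov bounds\<close>

context prob_space
begin

lemma expectation_exp_pos:
  fixes Y :: "'a \<Rightarrow> real"
  assumes "integrable M (\<lambda>\<omega>. exp (Y \<omega>))"
  shows "expectation (\<lambda>\<omega>. exp (Y \<omega>)) > 0"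
proof -
  have "expectation (\<lambda>\<omega>. exp (Y \<omega>)) \<noteq> 0"
    using assms by (subst integral_nonneg_eq_0_iff_AE) auto
  moreover have "expectation (\<lambda>\<omega>. exp (Y \<omega>)) \<ge> 0" by simp
  ultimately show ?thesis by linarith
qed

text \<open>On \<open>A\<close> the factor \<open>exp (v * Y \<omega> - m)\<close> is at least 1.
  This is the Chernoff bound for the measure with unnormalised density
  \<open>exp (w * Y \<omega>)\<close>; the case \<open>w = 0\<close> is the usual one.\<close>

lemma exponential_tilted_markov:
  fixes Y :: "'a \<Rightarrow> real"
  assumes int: "integrable M (\<lambda>\<omega>. exp ((w + v) * Y \<omega>))" "integrable M (\<lambda>\<omega>. exp (w * Y \<omega>))"
    and A: "A \<in> events" and le: "\<And>\<omega>. \<omega> \<in> A \<Longrightarrow> m \<le> v * Y \<omega>"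
  shows "expectation (\<lambda>\<omega>. exp (w * Y \<omega>) * indicator A \<omega>)
           \<le> exp (- m) * expectation (\<lambda>\<omega>. exp ((w + v) * Y \<omega>))"
proof -
  have "expectation (\<lambda>\<omega>. exp (w * Y \<omega>) * indicator A \<omega>)
      \<le> expectation (\<lambda>\<omega>. exp (- m) * exp ((w + v) * Y \<omega>))"
  proof (rule integral_mono)
    show "integrable M (\<lambda>\<omega>. exp (w * Y \<omega>) * indicator A \<omega>)"
      using int(2) A by (rule integrable_real_mult_indicator[rotated])
    show "integrable M (\<lambda>\<omega>. exp (- m) * exp ((w + v) * Y \<omega>))" using int(1) by simp
    fix \<omega> show "exp (w * Y \<omega>) * indicator A \<omega> \<le> exp (- m) * exp ((w + v) * Y \<omega>)"
      using le[of \<omega>] by (auto simp: indicator_def algebra_simps simp flip: exp_add)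
  qed
  thus ?thesis by simp
qed

end

text \<open>A limit that is finite and differentiable on the whole line stands in for the essential
  smoothness of the general Gaertner-Ellis theorem.\<close>

locale scaled_cgf_limit = prob_space +
  fixes Z :: "nat \<Rightarrow> 'a \<Rightarrow> real" and \<nu> :: "nat \<Rightarrow> real" and \<Lambda> \<Lambda>' :: "real \<Rightarrow> real"
  assumes speed: "filterlim \<nu> at_top sequentially"
    and Z_measurable [measurable]: "\<And>n. Z n \<in> borel_measurable M"
    and mgf_integrable: "\<And>n u. integrable M (\<lambda>\<omega>. exp (u * Z n \<omega>))"
    and cgf_tendsto:
      "\<And>u. (\<lambda>n. ln (expectation (\<lambda>\<omega>. exp (\<nu> n * u * Z n \<omega>))) / \<nu> n) \<longlonglongrightarrow> \<Lambda> u"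
    and cgf_deriv: "\<And>u. (\<Lambda> has_real_derivative \<Lambda>' u) (at u)"
begin

definition mgf :: "nat \<Rightarrow> real \<Rightarrow> real"
  where "mgf n u = expectation (\<lambda>\<omega>. exp (\<nu> n * u * Z n \<omega>))"

lemma mgf_pos: "mgf n u > 0"
  unfolding mgf_def by (intro expectation_exp_pos mgf_integrable)

lemma speed_pos: "eventually (\<lambda>n. \<nu> n > 0) sequentially"
  using speed by (simp add: filterlim_at_top_dense)

lemma cgf_zero: "\<Lambda> 0 = 0"
proof (rule LIMSEQ_unique)
  show "(\<lambda>n. ln (expectation (\<lambda>\<omega>. exp (\<nu> n * 0 * Z n \<omega>))) / \<nu> n) \<longlonglongrightarrow> 0"
    by (simp add: prob_space)
qed (rule cgf_tendsto)

lemma mgf_upper: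
  assumes "\<epsilon> > 0"
  shows "eventually (\<lambda>n. mgf n u \<le> exp (\<nu> n * (\<Lambda> u + \<epsilon>))) sequentially"
proof -
  have "eventually (\<lambda>n. ln (mgf n u) / \<nu> n < \<Lambda> u + \<epsilon>) sequentially"
    using cgf_tendsto[of u] assms unfolding mgf_def by (intro order_tendstoD(2)) auto
  thus ?thesis using speed_pos
  proof eventually_elim
    case (elim n)
    hence "ln (mgf n u) \<le> \<nu> n * (\<Lambda> u + \<epsilon>)" by (simp add: field_simps)
    thus ?case using mgf_pos by (metis exp_le_cancel_iff exp_ln)
  qed
qed

lemma mgf_lower:
  assumes "\<epsilon> > 0"
  shows "eventually (\<lambda>n. mgf n u \<ge> exp (\<nu> n * (\<Lambda> u - \<epsilon>))) sequentially"
proof -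
  have "eventually (\<lambda>n. ln (mgf n u) / \<nu> n > \<Lambda> u - \<epsilon>) sequentially"
    using cgf_tendsto[of u] assms unfolding mgf_def by (intro order_tendstoD(1)) auto
  thus ?thesis using speed_pos
  proof eventually_elim
    case (elim n)
    hence "ln (mgf n u) \<ge> \<nu> n * (\<Lambda> u - \<epsilon>)" by (simp add: field_simps)
    thus ?case using mgf_pos by (metis exp_le_cancel_iff exp_ln)
  qed
qed

lemma tilted_markov:
  assumes "S \<in> sets borel" and "\<nu> n > 0" and "\<And>z. z \<in> S \<Longrightarrow> m \<le> v * z"
  shows "expectation (\<lambda>\<omega>. exp (\<nu> n * w * Z n \<omega>) * indicator {\<omega>\<in>space M. Z n \<omega> \<in> S} \<omega>)
           \<le> exp (- (\<nu> n * m)) * mgf n (w + v)"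
proof -
  have "expectation (\<lambda>\<omega>. exp ((\<nu> n * w) * Z n \<omega>) * indicator {\<omega>\<in>space M. Z n \<omega> \<in> S} \<omega>)
      \<le> exp (- (\<nu> n * m)) * expectation (\<lambda>\<omega>. exp ((\<nu> n * w + \<nu> n * v) * Z n \<omega>))"
  proof (rule exponential_tilted_markov)
    show "{\<omega>\<in>space M. Z n \<omega> \<in> S} \<in> events" using assms(1) by measurable
    show "\<nu> n * m \<le> \<nu> n * v * Z n \<omega>" if "\<omega> \<in> {\<omega>\<in>space M. Z n \<omega> \<in> S}" for \<omega>
      using assms(2) assms(3)[of "Z n \<omega>"] that by simp
  qed (rule mgf_integrable)+
  thus ?thesis by (simp add: mgf_def distrib_left)
qed

lemma markov:
  assumes "S \<in> sets borel" and "\<nu> n > 0" and "\<And>z. z \<in> S \<Longrightarrow> m \<le> v * z"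
  shows "prob {\<omega>\<in>space M. Z n \<omega> \<in> S} \<le> exp (- (\<nu> n * m)) * mgf n v"
proof -
  have [measurable]: "S \<in> sets borel" by fact
  have "{\<omega>\<in>space M. Z n \<omega> \<in> S} \<in> events" by measurable
  thus ?thesis using tilted_markov[OF assms, of 0] by simp
qed

lemma markov_eventually:
  assumes "S \<in> sets borel" and "\<And>z. z \<in> S \<Longrightarrow> m \<le> v * z" and "\<alpha> < m - \<Lambda> v"
  shows "eventually (\<lambda>n. prob {\<omega>\<in>space M. Z n \<omega> \<in> S} \<le> exp (- (\<nu> n * \<alpha>))) sequentially"
proof -
  \<comment> \<open>The whole gap between \<open>\<alpha>\<close> and \<open>m - \<Lambda> v\<close>
    is spent on the error of the limit.\<close>
  have "eventually (\<lambda>n. mgf n v \<le> exp (\<nu> n * (\<Lambda> v + (m - \<Lambda> v - \<alpha>)))) sequentially"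
    using assms(3) by (intro mgf_upper) simp
  thus ?thesis using speed_pos
  proof eventually_elim
    case (elim n)
    have "prob {\<omega>\<in>space M. Z n \<omega> \<in> S} \<le> exp (- (\<nu> n * m)) * mgf n v"
      using assms(1) elim(2) assms(2) by (rule markov)
    also have "\<dots> \<le> exp (- (\<nu> n * m)) * exp (\<nu> n * (\<Lambda> v + (m - \<Lambda> v - \<alpha>)))"
      using elim(1) by simp
    also have "\<dots> = exp (- (\<nu> n * \<alpha>))" by (simp add: algebra_simps flip: exp_add)
    finally show ?case .
  qed
qed

text \<open>Under the law tilted by \<open>exp (\<nu> n * u * Z n \<omega>)\<close> each of the two
  tails outside the window around \<open>\<Lambda>' u\<close> carries at most a quarter of the mass,
  so the window keeps at least half. Undoing the tilt on the window costs at most \<open>exp (\<nu>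
  n * (u * \<Lambda>' u + \<bar>u\<bar> * \<delta>))\<close>.\<close>

lemma prob_near_slope_lower:
  assumes "\<delta> > 0" and "\<epsilon> > 0"
  shows "eventually (\<lambda>n. prob {\<omega>\<in>space M. Z n \<omega> \<in> {\<Lambda>' u - \<delta><..<\<Lambda>' u + \<delta>}}
           \<ge> 1 / 2 * exp (- (\<nu> n * (u * \<Lambda>' u - \<Lambda> u + \<bar>u\<bar> * \<delta> + \<epsilon>)))) sequentially"
proof -
  define y where "y = \<Lambda>' u"
  have "((\<lambda>v. (\<Lambda> (u + v) - \<Lambda> u) / v) \<longlongrightarrow> y) (at 0)"
    using cgf_deriv[of u] by (simp add: y_def DERIV_def)
  hence "eventually (\<lambda>v. dist ((\<Lambda> (u + v) - \<Lambda> u) / v) y < \<delta>) (at 0)"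
    using assms(1) by (rule tendstoD)
  then obtain r where "r > 0"
    and r: "\<And>v. v \<noteq> 0 \<Longrightarrow> \<bar>v\<bar> < r \<Longrightarrow> \<bar>(\<Lambda> (u + v) - \<Lambda> u) / v - y\<bar> < \<delta>"
    by (auto simp: eventually_at dist_real_def)
  define v where "v = r / 2"
  have "v > 0" "v < r" using \<open>r > 0\<close> by (auto simp: v_def)
  \<comment> \<open>Shifting the tilt from \<open>u\<close> by \<open>v\<close> or
    \<open>- v\<close> changes \<open>\<Lambda>\<close> by strictly less than the Chernoff bound
    gains at the thresholds \<open>y + \<delta>\<close> and \<open>y - \<delta>\<close>.\<close>
  have up: "\<Lambda> (u + v) < \<Lambda> u + v * y + v * \<delta>"
    using r[of v] \<open>v > 0\<close> \<open>v < r\<close> by (simp add: abs_less_iff field_simps)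
  have dn: "\<Lambda> (u + - v) < \<Lambda> u - v * y + v * \<delta>"
    using r[of "- v"] \<open>v > 0\<close> \<open>v < r\<close> by (simp add: abs_less_iff field_simps)
  \<comment> \<open>A third of the smaller slack: one share pays for the upper estimate of the mgf
    at the shifted tilt, one for the lower estimate at \<open>u\<close>, and the last gives the
    tails their exponential decay.\<close>
  define \<eta> where "\<eta> = min (\<Lambda> u + v * y + v * \<delta> - \<Lambda> (u + v)) (\<Lambda> u - v * y + v * \<delta> - \<Lambda> (u + - v)) / 3"
  have "\<eta> > 0" using up dn by (simp add: \<eta>_def)
  have up': "\<Lambda> (u + v) \<le> \<Lambda> u + v * y + v * \<delta> - 3 * \<eta>"
    and dn': "\<Lambda> (u + - v) \<le> \<Lambda> u - v * y + v * \<delta> - 3 * \<eta>" by (auto simp: \<eta>_def)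
  have small: "eventually (\<lambda>n. exp (- (\<nu> n * \<eta>)) \<le> 1 / 4) sequentially"
  proof -
    have "eventually (\<lambda>n. \<nu> n \<ge> ln 4 / \<eta>) sequentially"
      using speed by (simp add: filterlim_at_top)
    thus ?thesis
    proof eventually_elim
      case (elim n)
      hence "- (\<nu> n * \<eta>) \<le> - ln 4" using \<open>\<eta> > 0\<close> by (simp add: field_simps)
      hence "exp (- (\<nu> n * \<eta>)) \<le> exp (- ln 4)" by simp
      thus ?case by (simp add: exp_minus)
    qed
  qed
  show ?thesis
    using mgf_upper[OF \<open>\<eta> > 0\<close>, of "u + v"] mgf_upper[OF \<open>\<eta> > 0\<close>, of "u + - v"]
      mgf_lower[OF \<open>\<eta> > 0\<close>, of u] mgf_lower[OF \<open>\<epsilon> > 0\<close>, of u] small speed_pos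
  proof eventually_elim
    case (elim n)
    let ?E = "\<lambda>S. {\<omega>\<in>space M. Z n \<omega> \<in> S}"
    let ?T = "\<lambda>S. expectation (\<lambda>\<omega>. exp (\<nu> n * u * Z n \<omega>) * indicator (?E S) \<omega>)"
    have int: "integrable M (\<lambda>\<omega>. exp (\<nu> n * u * Z n \<omega>) * indicator (?E S) \<omega>)"
      if [measurable]: "S \<in> sets borel" for S
      by (rule integrable_real_mult_indicator) (auto intro: mgf_integrable)
    have tail: "?T S \<le> mgf n u / 4"
      if "S \<in> sets borel" "\<And>z. z \<in> S \<Longrightarrow> m \<le> w * z"
        "mgf n (u + w) \<le> exp (\<nu> n * (\<Lambda> (u + w) + \<eta>))" "\<Lambda> (u + w) \<le> \<Lambda> u + m - 3 * \<eta>" for S w m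
    proof -
      have "?T S \<le> exp (- (\<nu> n * m)) * mgf n (u + w)"
        by (rule tilted_markov) (use that elim in auto)
      also have "\<dots> \<le> exp (- (\<nu> n * m)) * exp (\<nu> n * (\<Lambda> (u + w) + \<eta>))"
        using that by simp
      also have "\<dots> \<le> exp (- (\<nu> n * m)) * exp (\<nu> n * (\<Lambda> u + m - 2 * \<eta>))"
        using that elim by simp
      also have "\<dots> = exp (- (\<nu> n * \<eta>)) * exp (\<nu> n * (\<Lambda> u - \<eta>))"
        by (simp add: algebra_simps flip: exp_add)
      also have "\<dots> \<le> 1 / 4 * mgf n u"
        using elim by (intro mult_mono) auto
      finally show ?thesis by simp
    qed
    have T1: "?T {y + \<delta>..} \<le> mgf n u / 4"
    proof (rule tail[of _ "v * (y + \<delta>)" v])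
        show "v * (y + \<delta>) \<le> v * z" if "z \<in> {y + \<delta>..}" for z
          using that \<open>v > 0\<close> by simp
      qed (use up' elim in \<open>simp_all add: distrib_left\<close>)
    have T2: "?T {..y - \<delta>} \<le> mgf n u / 4"
    proof (rule tail[of _ "- v * (y - \<delta>)" "- v"])
        show "- v * (y - \<delta>) \<le> - v * z" if "z \<in> {..y - \<delta>}" for z
          using that \<open>v > 0\<close> by simp
      qed (use dn' elim in \<open>simp_all add: right_diff_distrib\<close>)
    have "mgf n u = expectation (\<lambda>\<omega>. exp (\<nu> n * u * Z n \<omega>) * indicator (?E {y - \<delta><..<y + \<delta>}) \<omega>
       + exp (\<nu> n * u * Z n \<omega>) * indicator (?E {y + \<delta>..}) \<omega>
       + exp (\<nu> n * u * Z n \<omega>) * indicator (?E {..y - \<delta>}) \<omega>)"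
      unfolding mgf_def using \<open>\<delta> > 0\<close>
      by (intro Bochner_Integration.integral_cong) (auto simp: indicator_def)
    also have "\<dots> = ?T {y - \<delta><..<y + \<delta>} + ?T {y + \<delta>..} + ?T {..y - \<delta>}"
      by (subst Bochner_Integration.integral_add | (intro Bochner_Integration.integrable_add int; simp))+ simp
    finally have mid: "mgf n u / 2 \<le> ?T {y - \<delta><..<y + \<delta>}" using T1 T2 by linarith
    define m where "m = u * y + \<bar>u\<bar> * \<delta>"
    have m: "u * z \<le> m" if "z \<in> {y - \<delta><..<y + \<delta>}" for z
    proof -
      have "u * (z - y) \<le> \<bar>u\<bar> * \<bar>z - y\<bar>" by (metis abs_ge_self abs_mult)
      also have "\<dots> \<le> \<bar>u\<bar> * \<delta>" using that by (intro mult_left_mono) auto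
      finally show ?thesis by (simp add: m_def algebra_simps)
    qed
    have "?T {y - \<delta><..<y + \<delta>} \<le> expectation (\<lambda>\<omega>. exp (\<nu> n * m) * indicator (?E {y - \<delta><..<y + \<delta>}) \<omega>)"
    proof (rule integral_mono)
      show "integrable M (\<lambda>\<omega>. exp (\<nu> n * m) * indicator (?E {y - \<delta><..<y + \<delta>}) \<omega>)"
        by (intro integrable_real_mult_indicator) auto
      fix \<omega>
      show "exp (\<nu> n * u * Z n \<omega>) * indicator (?E {y - \<delta><..<y + \<delta>}) \<omega>
          \<le> exp (\<nu> n * m) * indicator (?E {y - \<delta><..<y + \<delta>}) \<omega>"
        using m[of "Z n \<omega>"] elim by (auto simp: indicator_def mult.assoc)
    qed (intro int, simp)
    also have "\<dots> = exp (\<nu> n * m) * prob (?E {y - \<delta><..<y + \<delta>})"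
      by simp
    finally have "exp (\<nu> n * (\<Lambda> u - \<epsilon>)) / 2 \<le> exp (\<nu> n * m) * prob (?E {y - \<delta><..<y + \<delta>})"
      using mid elim(4) by linarith
    hence "exp (- (\<nu> n * m)) * (exp (\<nu> n * (\<Lambda> u - \<epsilon>)) / 2)
        \<le> exp (- (\<nu> n * m)) * (exp (\<nu> n * m) * prob (?E {y - \<delta><..<y + \<delta>}))"
      by (intro mult_left_mono) auto
    also have "\<dots> = prob (?E {y - \<delta><..<y + \<delta>})"
      by (simp add: mult.assoc[symmetric] flip: exp_add)
    also have "exp (- (\<nu> n * m)) * (exp (\<nu> n * (\<Lambda> u - \<epsilon>)) / 2)
        = 1 / 2 * exp (- (\<nu> n * (u * y - \<Lambda> u + \<bar>u\<bar> * \<delta> + \<epsilon>)))"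
      by (simp add: m_def algebra_simps flip: exp_add)
    finally show ?case by (simp add: y_def)
  qed
qed

text \<open>The point \<open>t\<close> need not be a slope of \<open>\<Lambda>\<close>: a slope
  within \<open>r / 2\<close> of it suffices. The sign condition
  \<open>u * (t - \<Lambda>' u) \<ge> 0\<close> ensures that aiming at this slope is no more
  expensive than \<open>u * t - \<Lambda> u\<close>, hence than \<open>j\<close>.\<close>

lemma open_lower_bound:
  assumes "B \<in> sets borel" and "t \<in> interior B" and "legendre \<Lambda> t \<le> ereal j"
  shows "ereal (- j) \<le> liminf (\<lambda>n. scaled_log (\<nu> n) (prob {\<omega>\<in>space M. Z n \<omega> \<in> B}))"
    (is "_ \<le> ?L")
proof (rule ereal_le_epsilon2)
  fix \<epsilon> :: real assume "\<epsilon> > 0"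
  obtain r where "r > 0" and r: "ball t r \<subseteq> B"
    using assms(2) by (auto simp: mem_interior)
  have "((\<lambda>u. u * t - \<Lambda> u) has_real_derivative t - \<Lambda>' u) (at u)" for u
    by (auto intro!: derivative_eq_intros cgf_deriv)
  moreover have leg: "u * t - \<Lambda> u \<le> j" for u
    using legendre_upper[of u t \<Lambda>] assms(3) by (metis ereal_less_eq(3) order_trans)
  moreover have "r / 2 > 0" using \<open>r > 0\<close> by simp
  ultimately obtain u where u: "\<bar>t - \<Lambda>' u\<bar> < r / 2" "u * (t - \<Lambda>' u) \<ge> 0"
    by (rule bounded_above_almost_critical)
  \<comment> \<open>The first term keeps the window inside the ball around \<open>t\<close>, the
    second makes \<open>\<bar>u\<bar> * \<delta>\<close> at most \<open>\<epsilon> / 2\<close>;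
    adding 1 covers \<open>u = 0\<close>.\<close>
  define \<delta> where "\<delta> = min (r / 2) (\<epsilon> / 2 / (\<bar>u\<bar> + 1))"
  have "\<delta> > 0" using \<open>r > 0\<close> \<open>\<epsilon> > 0\<close> by (simp add: \<delta>_def)
  have "\<bar>u\<bar> * \<delta> \<le> (\<bar>u\<bar> + 1) * (\<epsilon> / 2 / (\<bar>u\<bar> + 1))"
    using \<open>\<delta> > 0\<close> by (intro mult_mono) (auto simp: \<delta>_def)
  also have "\<dots> = \<epsilon> / 2" by (simp add: field_simps)
  finally have "\<bar>u\<bar> * \<delta> \<le> \<epsilon> / 2" .
  hence exponent: "u * \<Lambda>' u - \<Lambda> u + \<bar>u\<bar> * \<delta> + \<epsilon> / 2 \<le> j + \<epsilon>"
    using u(2) leg[of u] by (simp add: algebra_simps)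
  have sub: "{\<Lambda>' u - \<delta><..<\<Lambda>' u + \<delta>} \<subseteq> B"
  proof (rule order_trans[OF _ r], rule subsetI)
    fix z assume "z \<in> {\<Lambda>' u - \<delta><..<\<Lambda>' u + \<delta>}"
    hence "\<bar>\<Lambda>' u - z\<bar> < \<delta>" by auto
    hence "\<bar>\<Lambda>' u - z\<bar> < r / 2" by (simp add: \<delta>_def)
    hence "\<bar>t - z\<bar> < r" using u(1) by arith
    thus "z \<in> ball t r" by (simp add: dist_real_def)
  qed
  have "\<epsilon> / 2 > 0" using \<open>\<epsilon> > 0\<close> by simp
  from prob_near_slope_lower[OF \<open>\<delta> > 0\<close> this, of u] speed_pos
  have "eventually (\<lambda>n. prob {\<omega>\<in>space M. Z n \<omega> \<in> B} \<ge> 1 / 2 * exp (- (\<nu> n * (j + \<epsilon>)))) sequentially"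
  proof eventually_elim
    case (elim n)
    have [measurable]: "B \<in> sets borel" by fact
    have "1 / 2 * exp (- (\<nu> n * (j + \<epsilon>)))
        \<le> 1 / 2 * exp (- (\<nu> n * (u * \<Lambda>' u - \<Lambda> u + \<bar>u\<bar> * \<delta> + \<epsilon> / 2)))"
      using exponent elim(2) by simp
    also note elim(1)
    also have "prob {\<omega>\<in>space M. Z n \<omega> \<in> {\<Lambda>' u - \<delta><..<\<Lambda>' u + \<delta>}} \<le> prob {\<omega>\<in>space M. Z n \<omega> \<in> B}"
      using sub by (intro finite_measure_mono) auto
    finally show ?case .
  qed
  from liminf_scaled_log_ge[OF speed _ this]
  have "ereal (- (j + \<epsilon>)) \<le> ?L" by simp
  hence "ereal (- (j + \<epsilon>)) + ereal \<epsilon> \<le> ?L + ereal \<epsilon>" by (rule add_right_mono)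
  thus "ereal (- j) \<le> ?L + ereal \<epsilon>" by simp
qed

text \<open>Two half-lines cover everything far out. On the compact remainder, each point of the
  closure has a slope \<open>u\<close> witnessing a conjugate value above \<open>\<alpha>\<close>,
  and Markov's inequality with this slope controls an open half-line around the point (the whole
  line or the empty set if \<open>u = 0\<close>). A finite subcover and a union bound
  finish.\<close>

lemma closed_upper_bound:
  assumes "B \<in> sets borel" and lt: "\<And>t. t \<in> closure B \<Longrightarrow> ereal \<alpha> < legendre \<Lambda> t"
  shows "limsup (\<lambda>n. scaled_log (\<nu> n) (prob {\<omega>\<in>space M. Z n \<omega> \<in> B})) \<le> ereal (- \<alpha>)"
proof -
  let ?E = "\<lambda>n S. {\<omega>\<in>space M. Z n \<omega> \<in> S}"
  \<comment> \<open>Exceeds both \<open>\<alpha> + \<Lambda> 1\<close> and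
    \<open>\<alpha> + \<Lambda> (- 1)\<close>, so the slopes 1 and -1 give the two outer half-lines
    a rate above \<open>\<alpha>\<close>.\<close>
  define R where "R = \<bar>\<alpha> + \<Lambda> 1\<bar> + \<bar>\<alpha> + \<Lambda> (- 1)\<bar> + 1"
  define good where "good S \<longleftrightarrow> S \<in> sets borel \<and>
    eventually (\<lambda>n. prob (?E n S) \<le> exp (- (\<nu> n * \<alpha>))) sequentially" for S
  have "good {R..}" unfolding good_def
    using markov_eventually[of "{R..}" R 1 \<alpha>] by (auto simp: R_def)
  have "good {..- R}" unfolding good_def
    using markov_eventually[of "{..- R}" R "- 1" \<alpha>] by (auto simp: R_def)
  have "\<exists>U. open U \<and> t \<in> U \<and> good U" if t: "t \<in> closure B" for t
  proof -
    obtain u where u: "\<alpha> < u * t - \<Lambda> u"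
      using lt[OF t] unfolding legendre_def less_SUP_iff by auto
    \<comment> \<open>The midpoint of \<open>\<alpha> + \<Lambda> u\<close> and
      \<open>u * t\<close>: strictly below \<open>u * t\<close>, so \<open>t\<close> lies in the
      open set, and strictly above \<open>\<alpha> + \<Lambda> u\<close>, so the decay is fast
      enough.\<close>
    define m where "m = (u * t + \<alpha> + \<Lambda> u) / 2"
    have m: "m < u * t" "\<alpha> < m - \<Lambda> u" using u by (auto simp: m_def field_simps)
    have "open {z. m < u * z}" by (intro open_Collect_less continuous_intros)
    moreover from this have "good {z. m < u * z}" unfolding good_def
      using m by (intro conjI markov_eventually[of _ m u \<alpha>]) auto
    ultimately show ?thesis using m by auto
  qed
  then obtain U where U: "\<And>t. t \<in> closure B \<Longrightarrow> open (U t) \<and> t \<in> U t \<and> good (U t)" by metis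
  have "compact (closure B \<inter> {-R..R})" by (simp add: closed_Int_compact)
  moreover have "\<And>t. t \<in> closure B \<inter> {-R..R} \<Longrightarrow> open (U t)" using U by blast
  moreover have "closure B \<inter> {-R..R} \<subseteq> (\<Union>t\<in>closure B \<inter> {-R..R}. U t)" using U by blast
  ultimately obtain C where C: "C \<subseteq> closure B \<inter> {-R..R}" "finite C"
      "closure B \<inter> {-R..R} \<subseteq> (\<Union>t\<in>C. U t)"
    by (rule compactE_image)
  define F where "F = insert {R..} (insert {..- R} (U ` C))"
  have "finite F" using C by (simp add: F_def)
  have good_F: "good S" if "S \<in> F" for S
    using that \<open>good {R..}\<close> \<open>good {..- R}\<close> U C by (auto simp: F_def)
  have cover: "B \<subseteq> \<Union>F"
  proof
    fix z assume "z \<in> B"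
    hence "z \<in> closure B" using closure_subset by blast
    thus "z \<in> \<Union>F" using C(3) by (cases "z \<in> {-R..R}") (auto simp: F_def)
  qed
  have "eventually (\<lambda>n. \<forall>S\<in>F. prob (?E n S) \<le> exp (- (\<nu> n * \<alpha>))) sequentially"
    using \<open>finite F\<close> good_F by (auto simp: eventually_ball_finite_distrib good_def)
  hence "eventually (\<lambda>n. prob (?E n B) \<le> real (card F) * exp (- (\<nu> n * \<alpha>))) sequentially"
  proof eventually_elim
    case (elim n)
    have meas: "?E n S \<in> events" if "S \<in> F" for S
    proof -
      have [measurable]: "S \<in> sets borel" using good_F[OF that] by (simp add: good_def)
      show ?thesis by measurable
    qed
    have "prob (?E n B) \<le> prob (\<Union>S\<in>F. ?E n S)"
      using cover meas \<open>finite F\<close> by (intro finite_measure_mono sets.finite_UN) auto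
    also have "\<dots> \<le> (\<Sum>S\<in>F. prob (?E n S))"
      using meas \<open>finite F\<close> by (intro finite_measure_subadditive_finite) auto
    also have "\<dots> \<le> (\<Sum>S\<in>F. exp (- (\<nu> n * \<alpha>)))" using elim by (intro sum_mono) auto
    finally show ?case by simp
  qed
  moreover have "real (card F) > 0" using \<open>finite F\<close> by (auto simp: F_def card_gt_0_iff)
  ultimately show ?thesis by (intro limsup_scaled_log_le[OF speed]) auto
qed

theorem gaertner_ellis:
  assumes "\<And>n. n \<ge> 1 \<Longrightarrow> \<nu> n > 0" and "\<And>n. n \<ge> 1 \<Longrightarrow> \<nu> n \<le> \<nu> (Suc n)"
  shows "LDP M Z \<nu> (legendre \<Lambda>)"
  unfolding LDP_def
proof (intro conjI ballI allI impI)
  fix B :: "real set" assume B: "B \<in> sets borel"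
  let ?p = "\<lambda>n. scaled_log (\<nu> n) (prob {\<omega>\<in>space M. Z n \<omega> \<in> B})"
  have "- legendre \<Lambda> t \<le> liminf ?p" if t: "t \<in> interior B" for t
  proof (cases "legendre \<Lambda> t")
    case (real j)
    thus ?thesis using open_lower_bound[OF B t, of j] by simp
  next
    case MInf
    thus ?thesis using legendre_upper[of 0 t \<Lambda>] by simp
  qed simp
  thus "- (INF t\<in>interior B. legendre \<Lambda> t) \<le> liminf ?p"
    by (simp add: ereal_SUP_uminus_eq[symmetric] SUP_le_iff)
  show "limsup ?p \<le> - (INF t\<in>closure B. legendre \<Lambda> t)"
  \<comment> \<open>A real number strictly between the two sides treats finite and infinite infima,
    and an empty closure, in the same way.\<close>
  proof (rule ccontr)
    assume "\<not> ?thesis"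
    then obtain r where r: "- (INF t\<in>closure B. legendre \<Lambda> t) < ereal r" "ereal r < limsup ?p"
      using ereal_dense2 by (meson not_le)
    hence "ereal (- r) < (INF t\<in>closure B. legendre \<Lambda> t)"
      by (metis ereal_uminus_less_reorder uminus_ereal.simps(1))
    hence "limsup ?p \<le> ereal (- (- r))"
      by (intro closed_upper_bound[OF B]) (meson INF_lower less_le_trans)
    thus False using r(2) by simp
  qed
qed (use assms speed good_rate_function_legendre[of \<Lambda>] cgf_zero in auto)

end

section \<open>Integrals of exponentials and averages\<close>

lemma abs_exp_minus_one_le:
  fixes y :: real
  assumes "\<bar>y\<bar> \<le> B"
  shows "\<bar>exp y - 1\<bar> \<le> \<bar>y\<bar> * exp B"
proof (cases "y \<ge> 0")
  case True
  have "1 + - y \<le> exp (- y)" by (rule exp_ge_add_one_self)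
  hence "(1 - y) * exp y \<le> exp (- y) * exp y" by (intro mult_right_mono) auto
  hence "exp y - 1 \<le> y * exp y" by (simp add: algebra_simps flip: exp_add)
  also have "\<dots> \<le> y * exp B" using True assms by (intro mult_left_mono) auto
  finally show ?thesis using True by simp
next
  case False
  have "1 - exp y \<le> - y" using exp_ge_add_one_self[of y] by linarith
  also have "\<dots> \<le> - y * exp B" using False assms by (simp add: mult_le_cancel_left1)
  finally show ?thesis using False by simp
qed

text \<open>Differentiation under the integral sign when only the product \<open>q p * w p\<close>
  is integrable. Since \<open>exp y - 1\<close> vanishes to first order at 0 and \<open>w\<close> is
  bounded, a multiple of \<open>\<bar>q p * w p\<bar>\<close> dominates the integrand, and likewise
  the difference quotients along any null sequence.\<close>

lemma
  fixes q w :: "'c \<Rightarrow> real"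
  assumes [measurable]: "q \<in> borel_measurable N" "w \<in> borel_measurable N"
    and int: "integrable N (\<lambda>p. q p * w p)" and B: "\<And>p. \<bar>w p\<bar> \<le> B"
  shows integrable_exp_minus_one: "integrable N (\<lambda>p. q p * (exp (u * w p) - 1))"
    and has_derivative_integral_exp_minus_one:
      "((\<lambda>u. LINT p|N. q p * (exp (u * w p) - 1)) has_real_derivative
         (LINT p|N. q p * w p * exp (u * w p))) (at u)"
proof -
  have "B \<ge> 0" using B[of undefined] by linarith
  have uw: "\<bar>v * w p\<bar> \<le> \<bar>v\<bar> * B" for v p
    using B[of p] by (simp add: abs_mult mult_left_mono)
  have bd: "\<bar>q p * (exp (v * w p) - 1)\<bar> \<le> \<bar>v\<bar> * exp (\<bar>v\<bar> * B) * \<bar>q p * w p\<bar>" for v p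
    using mult_left_mono[OF abs_exp_minus_one_le[OF uw[of v p]], of "\<bar>q p\<bar>"]
    by (simp add: abs_mult mult_ac)
  have I: "integrable N (\<lambda>p. q p * (exp (v * w p) - 1))" for v
  proof (rule Bochner_Integration.integrable_bound)
    show "integrable N (\<lambda>p. \<bar>v\<bar> * exp (\<bar>v\<bar> * B) * \<bar>q p * w p\<bar>)" using int by simp
    show "AE p in N. norm (q p * (exp (v * w p) - 1)) \<le> norm (\<bar>v\<bar> * exp (\<bar>v\<bar> * B) * \<bar>q p * w p\<bar>)"
      using bd[of _ v] by (simp add: abs_mult)
  qed simp
  show "integrable N (\<lambda>p. q p * (exp (u * w p) - 1))" by (rule I)
  show "((\<lambda>u. LINT p|N. q p * (exp (u * w p) - 1)) has_real_derivative
         (LINT p|N. q p * w p * exp (u * w p))) (at u)"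
    unfolding DERIV_def tendsto_at_iff_sequentially
  proof (intro allI impI)
    fix H :: "nat \<Rightarrow> real"
    assume nz: "\<forall>i. H i \<in> UNIV - {0}" and lim: "H \<longlonglongrightarrow> 0"
    have "Bseq H" using lim convergentI convergent_imp_Bseq by blast
    then obtain T where T: "\<And>n. \<bar>H n\<bar> \<le> T" by (auto simp: Bseq_def)
    have factor: "(a * (b * c - 1) - a * (b - 1)) / d = a * b * ((c - 1) / d)" for a b c d :: real
      by (simp add: algebra_simps diff_divide_distrib)
    let ?s = "\<lambda>n p. q p * exp (u * w p) * ((exp (H n * w p) - 1) / H n)"
    have eq: "((LINT p|N. q p * (exp ((u + H n) * w p) - 1)) - (LINT p|N. q p * (exp (u * w p) - 1))) / H n
       = (LINT p|N. ?s n p)" for n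
    proof -
      have "((LINT p|N. q p * (exp ((u + H n) * w p) - 1)) - (LINT p|N. q p * (exp (u * w p) - 1))) / H n
        = (LINT p|N. (q p * (exp ((u + H n) * w p) - 1) - q p * (exp (u * w p) - 1)) / H n)"
        by (subst Bochner_Integration.integral_diff[OF I I, symmetric]) simp
      also have "\<dots> = (LINT p|N. ?s n p)"
        by (intro Bochner_Integration.integral_cong refl) (simp only: distrib_right exp_add factor)
      finally show ?thesis .
    qed
    have "(\<lambda>n. LINT p|N. ?s n p) \<longlonglongrightarrow> (LINT p|N. q p * w p * exp (u * w p))"
    proof (rule integral_dominated_convergence)
      show "integrable N (\<lambda>p. exp (\<bar>u\<bar> * B) * exp (T * B) * \<bar>q p * w p\<bar>)" using int by simp
      show "AE p in N. (\<lambda>n. ?s n p) \<longlonglongrightarrow> q p * w p * exp (u * w p)"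
      proof (rule AE_I2)
        fix p
        have "((\<lambda>h. exp (h * w p)) has_real_derivative w p) (at 0)"
          by (auto intro!: derivative_eq_intros)
        hence "((\<lambda>h. (exp (h * w p) - 1) / h) \<longlongrightarrow> w p) (at 0)" by (simp add: DERIV_def)
        moreover have "filterlim H (at 0) sequentially"
          using lim nz by (auto simp: filterlim_at)
        ultimately have "(\<lambda>n. (exp (H n * w p) - 1) / H n) \<longlonglongrightarrow> w p"
          by (rule filterlim_compose)
        from tendsto_mult[OF tendsto_const[of "q p * exp (u * w p)"] this]
        show "(\<lambda>n. ?s n p) \<longlonglongrightarrow> q p * w p * exp (u * w p)" by (simp add: mult_ac)
      qed
      fix n
      show "AE p in N. norm (?s n p) \<le> exp (\<bar>u\<bar> * B) * exp (T * B) * \<bar>q p * w p\<bar>"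
      proof (rule AE_I2)
        fix p
        have "\<bar>H n * w p\<bar> \<le> T * B"
          using B[of p] T[of n] by (simp add: abs_mult mult_mono)
        hence "\<bar>exp (H n * w p) - 1\<bar> \<le> \<bar>H n * w p\<bar> * exp (T * B)"
          by (rule abs_exp_minus_one_le)
        hence "\<bar>(exp (H n * w p) - 1) / H n\<bar> \<le> \<bar>w p\<bar> * exp (T * B)"
          using nz by (simp add: abs_mult field_simps)
        moreover have "exp (u * w p) \<le> exp (\<bar>u\<bar> * B)" using uw[of u p] by simp
        ultimately have "\<bar>q p\<bar> * (exp (u * w p) * \<bar>(exp (H n * w p) - 1) / H n\<bar>)
            \<le> \<bar>q p\<bar> * (exp (\<bar>u\<bar> * B) * (\<bar>w p\<bar> * exp (T * B)))"
          by (intro mult_left_mono mult_mono) auto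
        thus "norm (?s n p) \<le> exp (\<bar>u\<bar> * B) * exp (T * B) * \<bar>q p * w p\<bar>"
          by (simp add: abs_mult mult_ac)
      qed
    qed simp_all
    thus "((\<lambda>h. ((LINT p|N. q p * (exp ((u + h) * w p) - 1)) - (LINT p|N. q p * (exp (u * w p) - 1))) / h) \<circ> H)
       \<longlonglongrightarrow> (LINT p|N. q p * w p * exp (u * w p))"
      by (simp add: o_def eq)
  qed
qed

lemma integral_lborel_affine:
  fixes g :: "'a::euclidean_space \<Rightarrow> real"
  assumes "c \<noteq> 0" and [measurable]: "g \<in> borel_measurable borel"
  shows "(LINT y|lborel. g y) = \<bar>c\<bar> ^ DIM('a) * (LINT z|lborel. g (t + c *\<^sub>R z))"
proof -
  have "(LINT y|lborel. g y) = (LINT y|density (distr lborel borel (\<lambda>z. t + c *\<^sub>R z)) (\<lambda>_. ennreal (\<bar>c\<bar> ^ DIM('a))). g y)"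
    using lborel_affine[OF assms(1), of t] by (simp add: ennreal_power)
  also have "\<dots> = \<bar>c\<bar> ^ DIM('a) * (LINT z|lborel. g (t + c *\<^sub>R z))"
    by (subst integral_density) (auto simp: integral_distr)
  finally show ?thesis .
qed

section \<open>Averages over indices as integrals over the unit interval\<close>

lemma ceiling_scaled_tendsto:
  fixes s :: real
  assumes "s > 0"
  shows "(\<lambda>n. real (nat \<lceil>real n * s\<rceil>) / real n) \<longlonglongrightarrow> s"
proof (rule tendsto_sandwich)
  show "\<forall>\<^sub>F n in sequentially. s \<le> real (nat \<lceil>real n * s\<rceil>) / real n"
    using eventually_gt_at_top[of 0]
  proof eventually_elim
    case (elim n)
    have "real n * s \<le> real (nat \<lceil>real n * s\<rceil>)" by (rule real_nat_ceiling_ge)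
    thus ?case using elim by (simp add: field_simps)
  qed
  show "\<forall>\<^sub>F n in sequentially. real (nat \<lceil>real n * s\<rceil>) / real n \<le> s + 1 / real n"
    using eventually_gt_at_top[of 0]
  proof eventually_elim
    case (elim n)
    have "0 \<le> real n * s" using assms by simp
    hence "real (nat \<lceil>real n * s\<rceil>) \<le> real n * s + 1" by linarith
    thus ?case using elim by (simp add: field_simps)
  qed
  have "(\<lambda>n. s + 1 / real n) \<longlonglongrightarrow> s + 0" by (intro tendsto_intros lim_1_over_n)
  thus "(\<lambda>n. s + 1 / real n) \<longlonglongrightarrow> s" by simp
qed simp

lemma ceiling_scaled_at_top:
  fixes s :: real
  assumes "s > 0"
  shows "filterlim (\<lambda>n. nat \<lceil>real n * s\<rceil>) at_top sequentially"
proof -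
  have "filterlim (\<lambda>n. s * real n) at_top sequentially"
    using tendsto_const assms filterlim_real_sequentially by (rule filterlim_tendsto_pos_mult_at_top)
  hence "filterlim (\<lambda>n. real n * s) at_top sequentially" by (simp add: mult.commute)
  hence "filterlim (\<lambda>n. real (nat \<lceil>real n * s\<rceil>)) at_top sequentially"
    by (rule filterlim_at_top_mono) (simp add: real_nat_ceiling_ge)
  thus ?thesis by (simp add: filterlim_sequentially_iff_filterlim_real)
qed

text \<open>The index \<open>nat \<lceil>real n * s\<rceil>\<close> equals \<open>i\<close> exactly
  on the cell from \<open>(i - 1) / n\<close> (excluded) to \<open>i / n\<close> (included). These
  cells have length \<open>1 / n\<close> and tile the half-open unit interval.\<close>

lemma average_eq_integral:
  fixes F :: "nat \<Rightarrow> real"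
  assumes "n \<ge> 1"
  shows "(\<Sum>i=1..n. F i) / real n = (LINT s:{0<..1}|lborel. F (nat \<lceil>real n * s\<rceil>))"
proof -
  let ?I = "\<lambda>i. {(real i - 1) / real n <.. real i / real n}"
  have n: "real n > 0" using assms by simp
  have ceil: "s \<in> ?I i \<longleftrightarrow> nat \<lceil>real n * s\<rceil> = i" if "i \<ge> 1" for i s
  proof -
    have "s \<in> ?I i \<longleftrightarrow> real i - 1 < real n * s \<and> real n * s \<le> real i"
      using n by (auto simp: field_simps)
    also have "\<dots> \<longleftrightarrow> \<lceil>real n * s\<rceil> = int i" by (simp add: ceiling_eq_iff)
    also have "\<dots> \<longleftrightarrow> nat \<lceil>real n * s\<rceil> = i" using that by auto
    finally show ?thesis .
  qed
  have range: "nat \<lceil>real n * s\<rceil> \<in> {1..n} \<longleftrightarrow> s \<in> {0<..1}" for s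
  proof -
    have "nat k \<in> {1..n} \<longleftrightarrow> 0 < k \<and> k \<le> int n" for k using assms by auto
    hence "nat \<lceil>real n * s\<rceil> \<in> {1..n} \<longleftrightarrow> 0 < \<lceil>real n * s\<rceil> \<and> \<lceil>real n * s\<rceil> \<le> int n" .
    also have "\<dots> \<longleftrightarrow> 0 < real n * s \<and> real n * s \<le> real n"
      by (simp add: zero_less_ceiling ceiling_le_iff)
    also have "\<dots> \<longleftrightarrow> s \<in> {0<..1}" using n by (auto simp: zero_less_mult_iff)
    finally show ?thesis .
  qed
  have "(LINT s:{0<..1}|lborel. F (nat \<lceil>real n * s\<rceil>))
      = (LINT s|lborel. (\<Sum>i=1..n. F i * indicator (?I i) s))"
    unfolding set_lebesgue_integral_def
  proof (intro Bochner_Integration.integral_cong refl)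
    fix s
    have "(\<Sum>i=1..n. F i * indicator (?I i) s)
        = (\<Sum>i=1..n. if nat \<lceil>real n * s\<rceil> = i then F i else 0)"
      using ceil by (intro sum.cong) (auto simp: indicator_def)
    also have "\<dots> = (if nat \<lceil>real n * s\<rceil> \<in> {1..n} then F (nat \<lceil>real n * s\<rceil>) else 0)"
      by (rule sum.delta') simp
    also have "\<dots> = indicator {0<..1} s *\<^sub>R F (nat \<lceil>real n * s\<rceil>)"
      by (subst range) (simp add: indicator_def)
    finally show "indicator {0<..1} s *\<^sub>R F (nat \<lceil>real n * s\<rceil>) = (\<Sum>i=1..n. F i * indicator (?I i) s)" ..
  qed
  also have "\<dots> = (\<Sum>i=1..n. LINT s|lborel. F i * indicator (?I i) s)"
    by (rule Bochner_Integration.integral_sum) (auto simp: emeasure_lborel_Ioc divide_right_mono)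
  also have "\<dots> = (\<Sum>i=1..n. F i / real n)"
  proof (intro sum.cong refl)
    fix i
    have "measure lborel (?I i) = 1 / real n"
      using n by (subst measure_lborel_Ioc) (auto simp: divide_right_mono diff_divide_distrib)
    thus "(LINT s|lborel. F i * indicator (?I i) s) = F i / real n" by simp
  qed
  finally show ?thesis by (simp add: sum_divide_distrib)
qed

lemma average_tendsto_integral:
  fixes F :: "nat \<Rightarrow> nat \<Rightarrow> real"
  assumes "set_integrable lborel {0<..1} w" and "g \<in> borel_measurable borel"
    and bound: "\<And>n s. n \<ge> 1 \<Longrightarrow> 0 < s \<Longrightarrow> s \<le> 1 \<Longrightarrow> \<bar>F n (nat \<lceil>real n * s\<rceil>)\<bar> \<le> w s"
    and lim: "\<And>s. 0 < s \<Longrightarrow> s \<le> 1 \<Longrightarrow> (\<lambda>n. F n (nat \<lceil>real n * s\<rceil>)) \<longlonglongrightarrow> g s"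
  shows "(\<lambda>n. (\<Sum>i=1..n. F n i) / real n) \<longlonglongrightarrow> (LINT s:{0<..1}|lborel. g s)"
proof -
  \<comment> \<open>The index is shifted because the majorant is available only for
    \<open>n \<ge> 1\<close>, while dominated convergence asks for it at every index.\<close>
  have "(\<lambda>n. LINT s|lborel. indicator {0<..1} s *\<^sub>R F (Suc n) (nat \<lceil>real (Suc n) * s\<rceil>))
     \<longlonglongrightarrow> (LINT s|lborel. indicator {0<..1} s *\<^sub>R g s)"
  proof (rule integral_dominated_convergence)
    show "integrable lborel (\<lambda>s. indicator {0<..1} s *\<^sub>R w s)"
      using assms(1) by (simp add: set_integrable_def)
    show "AE s in lborel. (\<lambda>n. indicator {0<..1} s *\<^sub>R F (Suc n) (nat \<lceil>real (Suc n) * s\<rceil>))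
        \<longlonglongrightarrow> indicator {0<..1} s *\<^sub>R g s"
      using LIMSEQ_Suc[OF lim] by (auto simp: indicator_def simp del: of_nat_Suc)
    show "AE s in lborel. norm (indicator {0<..1} s *\<^sub>R F (Suc n) (nat \<lceil>real (Suc n) * s\<rceil>))
        \<le> indicator {0<..1} s *\<^sub>R w s" for n
      using bound[of "Suc n"] by (auto simp: indicator_def simp del: of_nat_Suc)
  qed (use assms(2) in simp_all)
  hence "(\<lambda>n. (\<Sum>i=1..Suc n. F (Suc n) i) / real (Suc n)) \<longlonglongrightarrow> (LINT s:{0<..1}|lborel. g s)"
    by (subst average_eq_integral) (simp_all add: set_lebesgue_integral_def)
  thus ?thesis by (rule LIMSEQ_imp_Suc)
qed

section \<open>Averages of negative powers\<close>

lemma has_bochner_integral_powr_minus: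
  fixes b :: real
  assumes "b < 1"
  shows "has_bochner_integral lborel (\<lambda>s. indicator {0<..1} s *\<^sub>R s powr (- b)) (1 / (1 - b))"
proof (rule has_bochner_integral_nn_integral)
  have "((\<lambda>s. s powr (- b)) has_integral (1 powr (- b + 1) / (- b + 1))) {0..1}"
    using assms by (intro has_integral_powr_from_0) auto
  hence "(\<integral>\<^sup>+s. ennreal (s powr (- b)) * indicator {0..1} s \<partial>lborel) = ennreal (1 / (1 - b))"
    using nn_integral_has_integral_lebesgue'[of "{0..1}" "\<lambda>s. s powr (- b)" "1 / (1 - b)"] by simp
  \<comment> \<open>The two integrands agree even at 0, where \<open>0 powr (- b)\<close> is 0 by
    convention.\<close>
  also have "(\<integral>\<^sup>+s. ennreal (s powr (- b)) * indicator {0..1} s \<partial>lborel)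
     = (\<integral>\<^sup>+s. ennreal (indicator {0<..1} s *\<^sub>R s powr (- b)) \<partial>lborel)"
    by (intro nn_integral_cong) (auto simp: indicator_def)
  finally show "(\<integral>\<^sup>+s. ennreal (indicator {0<..1} s *\<^sub>R s powr (- b)) \<partial>lborel) = ennreal (1 / (1 - b))" .
qed (use assms in auto)

text \<open>A Riemann sum for the integral of \<open>s powr (- b)\<close>; this is the \<kappa> of
  the overview.\<close>

definition powr_average :: "real \<Rightarrow> nat \<Rightarrow> real"
  where "powr_average b n = (\<Sum>i=1..n. (real i / real n) powr (- b)) / real n"

lemma powr_average_tendsto:
  assumes "0 < b" and "b < 1"
  shows "powr_average b \<longlonglongrightarrow> 1 / (1 - b)"
proof -
  have bi: "has_bochner_integral lborel (\<lambda>s. indicator {0<..1} s *\<^sub>R s powr (- b)) (1 / (1 - b))"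
    using assms(2) by (rule has_bochner_integral_powr_minus)
  have "(\<lambda>n. (\<Sum>i=1..n. (real i / real n) powr (- b)) / real n)
     \<longlonglongrightarrow> (LINT s:{0<..1}|lborel. s powr (- b))"
  proof (rule average_tendsto_integral)
    show "set_integrable lborel {0<..1} (\<lambda>s. s powr (- b))"
      unfolding set_integrable_def using bi by (rule integrable.intros)
    fix s :: real assume s: "0 < s" "s \<le> 1"
    show "(\<lambda>n. (real (nat \<lceil>real n * s\<rceil>) / real n) powr - b) \<longlonglongrightarrow> s powr - b"
      using s by (intro tendsto_intros ceiling_scaled_tendsto) auto
    fix n :: nat assume "n \<ge> 1"
    \<comment> \<open>Rounding up moves away from the singularity at 0, so the limit function is its
      own majorant.\<close>
    have "real n * s \<le> real (nat \<lceil>real n * s\<rceil>)" by (rule real_nat_ceiling_ge)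
    hence "s \<le> real (nat \<lceil>real n * s\<rceil>) / real n" using \<open>n \<ge> 1\<close> by (simp add: field_simps)
    thus "\<bar>(real (nat \<lceil>real n * s\<rceil>) / real n) powr - b\<bar> \<le> s powr - b"
      using s assms by (simp add: powr_mono2')
  qed simp
  also have "(LINT s:{0<..1}|lborel. s powr (- b)) = 1 / (1 - b)"
    unfolding set_lebesgue_integral_def using bi by (rule has_bochner_integral_integral_eq)
  finally show ?thesis by (simp add: powr_average_def[abs_def])
qed

lemma powr_average_pos: "n \<ge> 1 \<Longrightarrow> powr_average b n > 0"
  unfolding powr_average_def by (intro divide_pos_pos sum_pos) auto

lemma sum_powr_eq_powr_average:
  assumes "n \<ge> 1"
  shows "(\<Sum>i=1..n. real i powr (- b)) = real n powr (1 - b) * powr_average b n"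
proof -
  have "real n powr (1 - b) * powr_average b n
      = (\<Sum>i=1..n. real n powr (1 - b) * (real i / real n) powr (- b) / real n)"
    by (simp add: powr_average_def sum_distrib_left sum_divide_distrib)
  also have "\<dots> = (\<Sum>i=1..n. real i powr (- b))"
  proof (intro sum.cong refl)
    fix i assume "i \<in> {1..n}"
    thus "real n powr (1 - b) * (real i / real n) powr (- b) / real n = real i powr (- b)"
      using assms by (simp add: powr_divide powr_diff powr_minus field_simps)
  qed
  finally show ?thesis ..
qed

section \<open>The recursive kernel estimator\<close>

locale recursive_kernel_estimator = prob_space M for M :: "'b measure" +
  fixes X :: "nat \<Rightarrow> 'b \<Rightarrow> 'a::euclidean_space" and f K :: "'a \<Rightarrow> real" and h :: "nat \<Rightarrow> real"
    and c a :: real and x :: 'a and F\<^sub>0 B :: real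
  assumes indep: "indep_vars (\<lambda>_. borel) X {1..}"
    and distr: "\<And>i. i \<ge> 1 \<Longrightarrow> distributed M lborel (X i) (\<lambda>y. ennreal (f y))"
    and f_nonneg: "\<And>y. f y \<ge> 0" and f_bound: "\<And>y. f y \<le> F\<^sub>0"
    and K_bound: "\<And>z. \<bar>K z\<bar> \<le> B" and K_integrable: "integrable lborel K"
    and c_pos: "c > 0" and a_pos: "0 < a" and a_less: "a < 1 / real DIM('a)"
    and bandwidth: "\<And>n. n \<ge> 1 \<Longrightarrow> h n = c * real n powr (- a)"
    and cont: "isCont f x"
begin

definition b :: real
  where "b = a * real DIM('a)"

text \<open>After the substitution \<open>y = x - \<eta> *\<^sub>R z\<close>, multiplying by
  \<open>\<eta> ^ DIM('a)\<close> gives the expectation of \<open>exp (\<theta> * K ((1 / \<eta>)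
  *\<^sub>R (x - X i \<omega>))) - 1\<close>.\<close>

definition smoothed :: "real \<Rightarrow> real \<Rightarrow> real"
  where "smoothed \<eta> \<theta> = (LINT z|lborel. f (x - \<eta> *\<^sub>R z) * (exp (\<theta> * K z) - 1))"

definition limit_cgf :: "real \<Rightarrow> real"
  where "limit_cgf \<theta> = (LINT z|lborel. exp (\<theta> * K z) - 1)"

definition local_cgf :: "real \<Rightarrow> real \<Rightarrow> real"
  where "local_cgf \<eta> \<theta> = ln (1 + \<eta> ^ DIM('a) * smoothed \<eta> \<theta>) / \<eta> ^ DIM('a)"

text \<open>The coefficient of the kernel value in
  \<open>speed n * u * rec_kde h K X n x \<omega>\<close>, after the powers of \<open>c\<close> have
  cancelled.\<close>

definition tilt :: "real \<Rightarrow> nat \<Rightarrow> nat \<Rightarrow> real"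
  where "tilt u n i = u * powr_average b n * (real i / real n) powr b"

lemma b_pos: "b > 0" and b_less: "b < 1"
  using a_pos a_less by (simp_all add: b_def field_simps)

lemma K_measurable [measurable]: "K \<in> borel_measurable borel"
  using borel_measurable_integrable[OF K_integrable] by simp

lemma f_measurable [measurable]: "f \<in> borel_measurable borel"
  using distributed_real_measurable[OF _ distr[of 1]] f_nonneg by simp

lemma X_measurable: "i \<ge> 1 \<Longrightarrow> X i \<in> borel_measurable M"
  using distributed_measurable[OF distr[of i]] by simp

lemma F0_nonneg: "F\<^sub>0 \<ge> 0" and B_nonneg: "B \<ge> 0"
  using f_nonneg[of x] f_bound[of x] K_bound[of 0] by linarith+

section \<open>The cumulant generating function of a single kernel term\<close>

lemma kernel_exp_bound:
  assumes "\<bar>\<theta>\<bar> \<le> T"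
  shows "\<bar>\<theta> * K z\<bar> \<le> T * B"
    and "\<bar>exp (\<theta> * K z) - 1\<bar> \<le> \<bar>\<theta>\<bar> * exp (T * B) * \<bar>K z\<bar>"
proof -
  show *: "\<bar>\<theta> * K z\<bar> \<le> T * B"
    using assms K_bound[of z] by (simp add: abs_mult mult_mono)
  show "\<bar>exp (\<theta> * K z) - 1\<bar> \<le> \<bar>\<theta>\<bar> * exp (T * B) * \<bar>K z\<bar>"
    using abs_exp_minus_one_le[OF *] by (simp add: abs_mult mult_ac)
qed

lemma smoothed_integrand_bound:
  assumes "\<bar>\<theta>\<bar> \<le> T"
  shows "\<bar>f y * (exp (\<theta> * K z) - 1)\<bar> \<le> F\<^sub>0 * (\<bar>\<theta>\<bar> * exp (T * B) * \<bar>K z\<bar>)"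
  using kernel_exp_bound(2)[OF assms, of z] f_nonneg[of y] f_bound[of y] F0_nonneg
  by (simp add: abs_mult mult_mono)

lemma abs_smoothed_le:
  assumes "\<bar>\<theta>\<bar> \<le> T"
  shows "\<bar>smoothed \<eta> \<theta>\<bar> \<le> F\<^sub>0 * exp (T * B) * (LINT z|lborel. \<bar>K z\<bar>) * \<bar>\<theta>\<bar>"
proof -
  have int: "integrable lborel (\<lambda>z. F\<^sub>0 * (\<bar>\<theta>\<bar> * exp (T * B) * \<bar>K z\<bar>))"
    using K_integrable by simp
  have "norm (smoothed \<eta> \<theta>) \<le> (LINT z|lborel. F\<^sub>0 * (\<bar>\<theta>\<bar> * exp (T * B) * \<bar>K z\<bar>))"
    unfolding smoothed_def
    by (rule Bochner_Integration.integral_norm_bound_integral[OF Bochner_Integration.integrable_bound[OF int] int])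
      (use smoothed_integrand_bound[OF assms] F0_nonneg in \<open>auto simp: abs_mult\<close>)
  thus ?thesis by (simp add: mult_ac)
qed

text \<open>For each fixed \<open>z\<close> the argument of \<open>f\<close> tends to
  \<open>x\<close>, so continuity at that one point gives pointwise convergence. As the sequence
  \<theta> is bounded, a constant multiple of \<open>\<bar>K z\<bar>\<close> dominates.\<close>

lemma smoothed_tendsto:
  assumes "\<eta> \<longlonglongrightarrow> 0" and "\<theta> \<longlonglongrightarrow> \<theta>'"
  shows "(\<lambda>n. smoothed (\<eta> n) (\<theta> n)) \<longlonglongrightarrow> f x * limit_cgf \<theta>'"
proof -
  have "Bseq \<theta>" using assms(2) convergentI convergent_imp_Bseq by blast
  then obtain T where T: "\<And>n. \<bar>\<theta> n\<bar> \<le> T" by (auto simp: Bseq_def)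
  have "(\<lambda>n. LINT z|lborel. f (x - \<eta> n *\<^sub>R z) * (exp (\<theta> n * K z) - 1))
     \<longlonglongrightarrow> (LINT z|lborel. f x * (exp (\<theta>' * K z) - 1))"
  proof (rule integral_dominated_convergence)
    show "integrable lborel (\<lambda>z. F\<^sub>0 * (T * exp (T * B) * \<bar>K z\<bar>))"
      using K_integrable by simp
    show "AE z in lborel. (\<lambda>n. f (x - \<eta> n *\<^sub>R z) * (exp (\<theta> n * K z) - 1)) \<longlonglongrightarrow> f x * (exp (\<theta>' * K z) - 1)"
    proof (rule AE_I2)
      fix z
      have "(\<lambda>n. x - \<eta> n *\<^sub>R z) \<longlonglongrightarrow> x - 0 *\<^sub>R z"
        by (intro tendsto_intros assms)
      hence "(\<lambda>n. f (x - \<eta> n *\<^sub>R z)) \<longlonglongrightarrow> f x"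
        by (intro isCont_tendsto_compose[OF cont]) simp
      thus "(\<lambda>n. f (x - \<eta> n *\<^sub>R z) * (exp (\<theta> n * K z) - 1)) \<longlonglongrightarrow> f x * (exp (\<theta>' * K z) - 1)"
        by (intro tendsto_intros assms)
    qed
    fix n
    show "AE z in lborel. norm (f (x - \<eta> n *\<^sub>R z) * (exp (\<theta> n * K z) - 1)) \<le> F\<^sub>0 * (T * exp (T * B) * \<bar>K z\<bar>)"
    proof (rule AE_I2)
      fix z
      have "norm (f (x - \<eta> n *\<^sub>R z) * (exp (\<theta> n * K z) - 1)) \<le> F\<^sub>0 * (\<bar>\<theta> n\<bar> * exp (T * B) * \<bar>K z\<bar>)"
        using smoothed_integrand_bound[OF T] by simp
      also have "\<dots> \<le> F\<^sub>0 * (T * exp (T * B) * \<bar>K z\<bar>)"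
        using T[of n] F0_nonneg by (intro mult_left_mono mult_right_mono) auto
      finally show "norm (f (x - \<eta> n *\<^sub>R z) * (exp (\<theta> n * K z) - 1)) \<le> F\<^sub>0 * (T * exp (T * B) * \<bar>K z\<bar>)" .
    qed
  qed simp_all
  thus ?thesis by (simp add: smoothed_def limit_cgf_def)
qed

lemma exp_kernel_integrable:
  assumes "i \<ge> 1"
  shows "integrable M (\<lambda>\<omega>. exp (\<theta> * K ((1 / \<eta>) *\<^sub>R (x - X i \<omega>))))"
proof (rule integrable_const_bound)
  have [measurable]: "X i \<in> borel_measurable M" using assms by (rule X_measurable)
  show "(\<lambda>\<omega>. exp (\<theta> * K ((1 / \<eta>) *\<^sub>R (x - X i \<omega>)))) \<in> borel_measurable M" by measurable
  have "\<theta> * K z \<le> \<bar>\<theta>\<bar> * B" for z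
    using kernel_exp_bound(1)[of \<theta> "\<bar>\<theta>\<bar>" z] by linarith
  thus "AE \<omega> in M. norm (exp (\<theta> * K ((1 / \<eta>) *\<^sub>R (x - X i \<omega>)))) \<le> exp (\<bar>\<theta>\<bar> * B)" by simp
qed

lemma expectation_exp_kernel:
  assumes "i \<ge> 1" and "\<eta> > 0"
  shows "expectation (\<lambda>\<omega>. exp (\<theta> * K ((1 / \<eta>) *\<^sub>R (x - X i \<omega>)))) = 1 + \<eta> ^ DIM('a) * smoothed \<eta> \<theta>"
proof -
  have "expectation (\<lambda>\<omega>. exp (\<theta> * K ((1 / \<eta>) *\<^sub>R (x - X i \<omega>)))) - 1
      = expectation (\<lambda>\<omega>. exp (\<theta> * K ((1 / \<eta>) *\<^sub>R (x - X i \<omega>))) - 1)"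
    by (subst Bochner_Integration.integral_diff[OF exp_kernel_integrable[OF assms(1)]])
      (simp_all add: prob_space)
  also have "\<dots> = (LINT y|lborel. f y * (exp (\<theta> * K ((1 / \<eta>) *\<^sub>R (x - y))) - 1))"
    by (rule distributed_integral[OF distr[OF assms(1)], symmetric]) (use f_nonneg in auto)
  also have "\<dots> = \<eta> ^ DIM('a) * smoothed \<eta> \<theta>"
    \<comment> \<open>The scaling factor is negative because the kernel sees \<open>x - y\<close>;
      the Jacobian takes its absolute value.\<close>
    using assms(2) by (subst integral_lborel_affine[of "- \<eta>" _ x]) (simp_all add: smoothed_def)
  finally show ?thesis by simp
qed

text \<open>The right-hand side is an expectation of an exponential whose exponent is at least
  \<open>- (T * B)\<close>. The bound is uniform in \<open>\<eta>\<close>.\<close>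

lemma one_plus_smoothed_ge:
  assumes "\<eta> > 0" and "\<bar>\<theta>\<bar> \<le> T"
  shows "exp (- (T * B)) \<le> 1 + \<eta> ^ DIM('a) * smoothed \<eta> \<theta>"
proof -
  have "expectation (\<lambda>_. exp (- (T * B))) \<le> expectation (\<lambda>\<omega>. exp (\<theta> * K ((1 / \<eta>) *\<^sub>R (x - X 1 \<omega>))))"
  proof (rule integral_mono)
    fix \<omega> show "exp (- (T * B)) \<le> exp (\<theta> * K ((1 / \<eta>) *\<^sub>R (x - X 1 \<omega>)))"
      using kernel_exp_bound(1)[OF assms(2), of "(1 / \<eta>) *\<^sub>R (x - X 1 \<omega>)"] by (simp add: abs_le_iff)
  qed (simp_all only: exp_kernel_integrable integrable_const order_refl)
  thus ?thesis using expectation_exp_kernel[of 1 \<eta> \<theta>] assms(1) by (simp add: prob_space)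
qed

lemma one_plus_smoothed_pos: "\<eta> > 0 \<Longrightarrow> 1 + \<eta> ^ DIM('a) * smoothed \<eta> \<theta> > 0"
  by (rule less_le_trans[OF _ one_plus_smoothed_ge[of \<eta> \<theta> "\<bar>\<theta>\<bar>"]]) auto

text \<open>Both bounds come from \<open>1 - 1 / y \<le> ln y \<le> y - 1\<close> at
  \<open>y = 1 + \<eta> ^ DIM('a) * smoothed \<eta> \<theta>\<close>. They coincide in the limit
  \<open>\<eta> \<longlonglongrightarrow> 0\<close>, which makes a Taylor expansion of the logarithm
  unnecessary.\<close>

lemma
  assumes "\<eta> > 0"
  shows local_cgf_le: "local_cgf \<eta> \<theta> \<le> smoothed \<eta> \<theta>"
    and local_cgf_ge: "smoothed \<eta> \<theta> / (1 + \<eta> ^ DIM('a) * smoothed \<eta> \<theta>) \<le> local_cgf \<eta> \<theta>"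
proof -
  define D where "D = \<eta> ^ DIM('a)"
  have "D > 0" using assms by (simp add: D_def)
  define y where "y = 1 + D * smoothed \<eta> \<theta>"
  have "y > 0" using one_plus_smoothed_pos[OF assms] by (simp add: y_def D_def)
  have "ln y \<le> y - 1" using \<open>y > 0\<close> by (rule ln_le_minus_one)
  thus "local_cgf \<eta> \<theta> \<le> smoothed \<eta> \<theta>"
    using \<open>D > 0\<close> by (simp add: local_cgf_def y_def D_def[symmetric] field_simps)
  have "ln (1 / y) \<le> 1 / y - 1" using \<open>y > 0\<close> by (intro ln_le_minus_one) simp
  hence "1 - 1 / y \<le> ln y" using \<open>y > 0\<close> by (simp add: ln_div)
  moreover have "1 - 1 / y = D * (smoothed \<eta> \<theta> / y)"
    using \<open>y > 0\<close> by (simp add: y_def field_simps)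
  ultimately have "D * (smoothed \<eta> \<theta> / y) \<le> ln y" by simp
  thus "smoothed \<eta> \<theta> / (1 + \<eta> ^ DIM('a) * smoothed \<eta> \<theta>) \<le> local_cgf \<eta> \<theta>"
    using \<open>D > 0\<close> unfolding local_cgf_def D_def[symmetric] y_def[symmetric]
    by (simp add: pos_le_divide_eq mult.commute)
qed

text \<open>The bound is uniform in \<open>\<eta>\<close> and keeps the factor
  \<open>\<bar>\<theta>\<bar>\<close>. With the tilts inserted, this factor later cancels the
  singular weight \<open>(real i / real n) powr (- b)\<close>.\<close>

lemma abs_local_cgf_le:
  assumes "\<eta> > 0" and "\<bar>\<theta>\<bar> \<le> T"
  shows "\<bar>local_cgf \<eta> \<theta>\<bar> \<le> exp (T * B) * (F\<^sub>0 * exp (T * B) * (LINT z|lborel. \<bar>K z\<bar>)) * \<bar>\<theta>\<bar>"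
proof -
  define S where "S = smoothed \<eta> \<theta>"
  define y where "y = 1 + \<eta> ^ DIM('a) * S"
  have "T \<ge> 0" using assms(2) by linarith
  have y: "exp (- (T * B)) \<le> y" using one_plus_smoothed_ge[OF assms] by (simp add: y_def S_def)
  have "y > 0" using y by (meson exp_gt_zero less_le_trans)
  have "1 / y \<le> exp (T * B)" using y \<open>y > 0\<close> by (simp add: exp_minus field_simps)
  hence "\<bar>S\<bar> * (1 / y) \<le> \<bar>S\<bar> * exp (T * B)" by (intro mult_left_mono) auto
  moreover have "- S * (1 / y) \<le> \<bar>S\<bar> * (1 / y)" using \<open>y > 0\<close> by (intro mult_right_mono) auto
  ultimately have "- (S / y) \<le> \<bar>S\<bar> * exp (T * B)" by simp
  moreover have "\<bar>S\<bar> * 1 \<le> \<bar>S\<bar> * exp (T * B)"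
    using \<open>T \<ge> 0\<close> B_nonneg by (intro mult_left_mono) auto
  ultimately have "\<bar>local_cgf \<eta> \<theta>\<bar> \<le> \<bar>S\<bar> * exp (T * B)"
    using local_cgf_le[OF assms(1), of \<theta>] local_cgf_ge[OF assms(1), of \<theta>]
    by (simp add: S_def y_def abs_le_iff)
  also have "\<dots> \<le> (F\<^sub>0 * exp (T * B) * (LINT z|lborel. \<bar>K z\<bar>) * \<bar>\<theta>\<bar>) * exp (T * B)"
    unfolding S_def using abs_smoothed_le[OF assms(2)] by (intro mult_right_mono) auto
  finally show ?thesis by (simp add: mult_ac)
qed

lemma local_cgf_tendsto:
  assumes "\<eta> \<longlonglongrightarrow> 0" and "\<theta> \<longlonglongrightarrow> \<theta>'" and pos: "eventually (\<lambda>n. \<eta> n > 0) sequentially"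
  shows "(\<lambda>n. local_cgf (\<eta> n) (\<theta> n)) \<longlonglongrightarrow> f x * limit_cgf \<theta>'"
proof (rule tendsto_sandwich)
  show "eventually (\<lambda>n. smoothed (\<eta> n) (\<theta> n) / (1 + \<eta> n ^ DIM('a) * smoothed (\<eta> n) (\<theta> n))
      \<le> local_cgf (\<eta> n) (\<theta> n)) sequentially"
    using pos by eventually_elim (rule local_cgf_ge)
  show "eventually (\<lambda>n. local_cgf (\<eta> n) (\<theta> n) \<le> smoothed (\<eta> n) (\<theta> n)) sequentially"
    using pos by eventually_elim (rule local_cgf_le)
  show lim: "(\<lambda>n. smoothed (\<eta> n) (\<theta> n)) \<longlonglongrightarrow> f x * limit_cgf \<theta>'"
    using assms by (intro smoothed_tendsto)
  have "(\<lambda>n. smoothed (\<eta> n) (\<theta> n) / (1 + \<eta> n ^ DIM('a) * smoothed (\<eta> n) (\<theta> n)))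
     \<longlonglongrightarrow> f x * limit_cgf \<theta>' / (1 + 0 ^ DIM('a) * (f x * limit_cgf \<theta>'))"
    by (intro tendsto_intros lim assms) (simp add: zero_power)
  thus "(\<lambda>n. smoothed (\<eta> n) (\<theta> n) / (1 + \<eta> n ^ DIM('a) * smoothed (\<eta> n) (\<theta> n)))
     \<longlonglongrightarrow> f x * limit_cgf \<theta>'" by (simp add: zero_power)
qed

section \<open>Bandwidths and the speed\<close>

lemma h_pos: "i \<ge> 1 \<Longrightarrow> h i > 0"
  using c_pos by (simp add: bandwidth)

lemma h_tendsto: "h \<longlonglongrightarrow> 0"
proof -
  have "(\<lambda>n. real n powr (- a)) \<longlonglongrightarrow> 0"
    using a_pos by (intro tendsto_neg_powr filterlim_real_sequentially) simp
  hence "(\<lambda>n. c * real n powr (- a)) \<longlonglongrightarrow> c * 0" by (intro tendsto_intros)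
  moreover have "eventually (\<lambda>n. h n = c * real n powr (- a)) sequentially"
    using eventually_ge_at_top[of 1] by eventually_elim (rule bandwidth)
  ultimately show ?thesis by (simp add: tendsto_cong)
qed

lemma h_power: "i \<ge> 1 \<Longrightarrow> h i ^ DIM('a) = c ^ DIM('a) * real i powr (- b)"
  by (simp add: bandwidth power_mult_distrib b_def powr_power mult.commute)

definition speed :: "nat \<Rightarrow> real"
  where "speed n = (\<Sum>i=1..n. h i ^ DIM('a))"

lemma speed_eq:
  assumes "n \<ge> 1"
  shows "speed n = c ^ DIM('a) * real n powr (1 - b) * powr_average b n"
proof -
  have "speed n = c ^ DIM('a) * (\<Sum>i=1..n. real i powr (- b))"
    by (simp add: speed_def h_power sum_distrib_left)
  thus ?thesis using sum_powr_eq_powr_average[OF assms, of b] by simp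
qed

lemma speed_pos: "n \<ge> 1 \<Longrightarrow> speed n > 0"
  unfolding speed_def by (intro sum_pos) (auto simp: h_pos)

lemma speed_at_top: "filterlim speed at_top sequentially"
proof -
  have "filterlim (\<lambda>n. powr_average b n * real n powr (1 - b)) at_top sequentially"
  proof (rule filterlim_tendsto_pos_mult_at_top)
    show "powr_average b \<longlonglongrightarrow> 1 / (1 - b)" using b_pos b_less by (rule powr_average_tendsto)
    show "0 < 1 / (1 - b)" using b_less by simp
    have "filterlim (\<lambda>n. exp ((1 - b) * ln (real n))) at_top sequentially"
      using b_less by (intro filterlim_compose[OF exp_at_top]
          filterlim_tendsto_pos_mult_at_top[OF tendsto_const]
          filterlim_compose[OF ln_at_top filterlim_real_sequentially]) simp
    moreover have "eventually (\<lambda>n. real n powr (1 - b) = exp ((1 - b) * ln (real n))) sequentially"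
      using eventually_ge_at_top[of 1] by eventually_elim (simp add: powr_def)
    ultimately show "filterlim (\<lambda>n. real n powr (1 - b)) at_top sequentially"
      by (simp add: filterlim_cong)
  qed
  hence "filterlim (\<lambda>n. c ^ DIM('a) * (powr_average b n * real n powr (1 - b))) at_top sequentially"
    using c_pos by (intro filterlim_tendsto_pos_mult_at_top[OF tendsto_const]) auto
  moreover have "eventually (\<lambda>n. speed n = c ^ DIM('a) * (powr_average b n * real n powr (1 - b))) sequentially"
    using eventually_ge_at_top[of 1] by eventually_elim (simp add: speed_eq mult_ac)
  ultimately show ?thesis by (simp add: filterlim_cong)
qed

lemma tilt_eq:
  assumes "i \<ge> 1" and "i \<le> n"
  shows "speed n * u * (1 / real n) * h i powr (- real DIM('a)) = tilt u n i"
proof -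
  have "n \<ge> 1" using assms by simp
  have "h i powr (- real DIM('a)) = 1 / (h i ^ DIM('a))"
    using h_pos[OF assms(1)] by (simp add: powr_minus powr_realpow divide_inverse)
  also have "\<dots> = real i powr b / c ^ DIM('a)"
    using assms by (simp add: h_power powr_minus field_simps)
  finally have "speed n * u * (1 / real n) * h i powr (- real DIM('a))
     = (c ^ DIM('a) * real n powr (1 - b) * powr_average b n) * u * (1 / real n) * (real i powr b / c ^ DIM('a))"
    using speed_eq[OF \<open>n \<ge> 1\<close>] by simp
  also have "\<dots> = tilt u n i"
    using c_pos \<open>n \<ge> 1\<close> by (simp add: tilt_def powr_divide powr_diff field_simps)
  finally show ?thesis .
qed

text \<open>Turns the scaled logarithm of a product over \<open>i\<close> into a weighted average of
  the \<open>local_cgf\<close> values, with weights that depend on \<open>i\<close> only through the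
  ratio of \<open>i\<close> to \<open>n\<close>, up to normalisation.\<close>

lemma weight_eq:
  assumes "i \<ge> 1" and "i \<le> n"
  shows "h i ^ DIM('a) / speed n = (real i / real n) powr (- b) / real n / powr_average b n"
  using assms c_pos powr_average_pos[of n b]
  by (simp add: h_power speed_eq powr_divide powr_diff powr_minus field_simps)

section \<open>The moment generating function of the estimator\<close>

lemma estimator_measurable [measurable]: "rec_kde h K X n x \<in> borel_measurable M"
proof -
  have "(\<lambda>\<omega>. h i powr (- real DIM('a)) * K ((1 / h i) *\<^sub>R (x - X i \<omega>))) \<in> borel_measurable M"
    if "i \<in> {1..n}" for i
  proof -
    have [measurable]: "X i \<in> borel_measurable M" using that by (intro X_measurable) simp
    show ?thesis by measurable
  qed
  hence "(\<lambda>\<omega>. \<Sum>i=1..n. h i powr (- real DIM('a)) * K ((1 / h i) *\<^sub>R (x - X i \<omega>))) \<in> borel_measurable M"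
    by (rule borel_measurable_sum)
  from borel_measurable_times[OF borel_measurable_const[of "1 / real n"] this]
  show ?thesis unfolding rec_kde_def[abs_def] .
qed

lemma estimator_bounded: "\<exists>C. \<forall>\<omega>. \<bar>rec_kde h K X n x \<omega>\<bar> \<le> C"
proof (intro exI allI)
  fix \<omega>
  have "\<bar>rec_kde h K X n x \<omega>\<bar>
      \<le> (1 / real n) * (\<Sum>i=1..n. \<bar>h i powr (- real DIM('a)) * K ((1 / h i) *\<^sub>R (x - X i \<omega>))\<bar>)"
    unfolding rec_kde_def abs_mult[of "1 / real n"] by (intro mult_mono sum_abs) auto
  also have "\<dots> \<le> (1 / real n) * (\<Sum>i=1..n. h i powr (- real DIM('a)) * B)"
    using K_bound by (intro mult_left_mono sum_mono) (auto simp: abs_mult intro!: mult_left_mono)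
  finally show "\<bar>rec_kde h K X n x \<omega>\<bar> \<le> (1 / real n) * (\<Sum>i=1..n. h i powr (- real DIM('a)) * B)" .
qed

lemma estimator_mgf_integrable: "integrable M (\<lambda>\<omega>. exp (u * (rec_kde h K X n x \<omega> - f x)))"
proof -
  obtain C where C: "\<And>\<omega>. \<bar>rec_kde h K X n x \<omega>\<bar> \<le> C" using estimator_bounded by blast
  show ?thesis
  proof (rule integrable_const_bound)
    show "AE \<omega> in M. norm (exp (u * (rec_kde h K X n x \<omega> - f x))) \<le> exp (\<bar>u\<bar> * (C + \<bar>f x\<bar>))"
    proof (rule AE_I2)
      fix \<omega>
      have "u * (rec_kde h K X n x \<omega> - f x) \<le> \<bar>u\<bar> * \<bar>rec_kde h K X n x \<omega> - f x\<bar>"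
        by (metis abs_ge_self abs_mult)
      also have "\<dots> \<le> \<bar>u\<bar> * (C + \<bar>f x\<bar>)"
        using C[of \<omega>] by (intro mult_left_mono) auto
      finally show "norm (exp (u * (rec_kde h K X n x \<omega> - f x))) \<le> exp (\<bar>u\<bar> * (C + \<bar>f x\<bar>))" by simp
    qed
  qed measurable
qed

lemma estimator_mgf:
  assumes "n \<ge> 1"
  shows "expectation (\<lambda>\<omega>. exp (speed n * u * (rec_kde h K X n x \<omega> - f x)))
     = exp (- (speed n * u * f x)) * (\<Prod>i=1..n. 1 + h i ^ DIM('a) * smoothed (h i) (tilt u n i))"
proof -
  let ?Y = "\<lambda>i \<omega>. exp (tilt u n i * K ((1 / h i) *\<^sub>R (x - X i \<omega>)))"
  have eq: "exp (speed n * u * (rec_kde h K X n x \<omega> - f x)) = exp (- (speed n * u * f x)) * (\<Prod>i=1..n. ?Y i \<omega>)"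
    for \<omega>
  proof -
    have "speed n * u * rec_kde h K X n x \<omega>
        = (\<Sum>i=1..n. (speed n * u * (1 / real n) * h i powr (- real DIM('a))) * K ((1 / h i) *\<^sub>R (x - X i \<omega>)))"
      by (simp add: rec_kde_def sum_distrib_left mult_ac sum_divide_distrib)
    also have "\<dots> = (\<Sum>i=1..n. tilt u n i * K ((1 / h i) *\<^sub>R (x - X i \<omega>)))"
      by (intro sum.cong refl) (subst tilt_eq, auto)
    finally have "speed n * u * (rec_kde h K X n x \<omega> - f x)
        = - (speed n * u * f x) + (\<Sum>i=1..n. tilt u n i * K ((1 / h i) *\<^sub>R (x - X i \<omega>)))"
      by (simp add: right_diff_distrib)
    thus ?thesis by (simp only: exp_add exp_sum finite_atLeastAtMost)
  qed
  have "indep_vars (\<lambda>_. borel) X {1..n}" using indep by (rule indep_vars_subset) auto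
  hence "indep_vars (\<lambda>_. borel) ?Y {1..n}"
    by (rule indep_vars_compose2[where Y = "\<lambda>i y. exp (tilt u n i * K ((1 / h i) *\<^sub>R (x - y)))"]) simp
  hence "expectation (\<lambda>\<omega>. \<Prod>i=1..n. ?Y i \<omega>) = (\<Prod>i=1..n. expectation (?Y i))"
    by (intro indep_vars_lebesgue_integral) (auto intro: exp_kernel_integrable)
  also have "\<dots> = (\<Prod>i=1..n. 1 + h i ^ DIM('a) * smoothed (h i) (tilt u n i))"
    by (intro prod.cong refl expectation_exp_kernel) (auto simp: h_pos)
  finally show ?thesis by (simp add: eq)
qed

text \<open>By independence the logarithm of the mgf is a sum over the observations;
  \<open>weight_eq\<close> then normalises each summand.\<close>

lemma estimator_cgf:
  assumes "n \<ge> 1"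
  shows "ln (expectation (\<lambda>\<omega>. exp (speed n * u * (rec_kde h K X n x \<omega> - f x)))) / speed n
     = (\<Sum>i=1..n. (real i / real n) powr (- b) * local_cgf (h i) (tilt u n i)) / real n / powr_average b n - u * f x"
proof -
  let ?p = "\<lambda>i. 1 + h i ^ DIM('a) * smoothed (h i) (tilt u n i)"
  have pos: "?p i > 0" if "i \<in> {1..n}" for i using that by (intro one_plus_smoothed_pos h_pos) simp
  have "ln (expectation (\<lambda>\<omega>. exp (speed n * u * (rec_kde h K X n x \<omega> - f x))))
     = - (speed n * u * f x) + (\<Sum>i=1..n. ln (?p i))"
  proof -
    have "(\<Prod>i=1..n. ?p i) > 0" using pos by (rule prod_pos)
    moreover have "ln (\<Prod>i=1..n. ?p i) = (\<Sum>i=1..n. ln (?p i))"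
      using pos by (intro ln_prod) (metis finite_atLeastAtMost, metis less_irrefl)
    ultimately show ?thesis
      unfolding estimator_mgf[OF assms] by (subst ln_mult_pos) (simp_all only: exp_gt_zero ln_exp)
  qed
  also have "\<dots> / speed n = (\<Sum>i=1..n. ln (?p i) / speed n) - u * f x"
    using speed_pos[OF assms] by (simp add: diff_divide_distrib sum_divide_distrib)
  also have "(\<Sum>i=1..n. ln (?p i) / speed n)
     = (\<Sum>i=1..n. (real i / real n) powr (- b) * local_cgf (h i) (tilt u n i) / real n / powr_average b n)"
  proof (intro sum.cong refl)
    fix i assume i: "i \<in> {1..n}"
    hence "h i > 0" by (intro h_pos) simp
    hence "ln (?p i) / speed n = (h i ^ DIM('a) / speed n) * local_cgf (h i) (tilt u n i)"
      by (simp add: local_cgf_def)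
    also have "\<dots> = (real i / real n) powr (- b) / real n / powr_average b n * local_cgf (h i) (tilt u n i)"
      using i by (subst weight_eq) auto
    finally show "ln (?p i) / speed n
        = (real i / real n) powr (- b) * local_cgf (h i) (tilt u n i) / real n / powr_average b n"
      by simp
  qed
  finally show ?thesis by (simp add: sum_divide_distrib)
qed

section \<open>The function \<open>kde_psi\<close>, its derivative and its iterated form\<close>

definition psi_weight :: "real \<times> 'a \<Rightarrow> real"
  where "psi_weight p = indicator {0..1} (fst p) * fst p powr (- b)"

text \<open>
  The indicator is redundant for the integrand, but makes the exponent globally bounded.
\<close>
definition psi_exponent :: "real \<times> 'a \<Rightarrow> real"
  where "psi_exponent p = indicator {0..1} (fst p) * (fst p powr b * K (snd p) / (1 - b))"

lemma psi_measurable [measurable]: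
  "psi_weight \<in> borel_measurable borel" "psi_exponent \<in> borel_measurable borel"
  unfolding psi_weight_def[abs_def] psi_exponent_def[abs_def] borel_prod[symmetric] by measurable

lemma kde_psi_eq_exp_integral:
  "kde_psi a K u = (LINT p|lborel. psi_weight p * (exp (u * psi_exponent p) - 1))"
  unfolding kde_psi_def set_lebesgue_integral_def b_def[symmetric]
  by (intro Bochner_Integration.integral_cong refl)
    (auto simp: psi_weight_def psi_exponent_def indicator_def mult_ac)

lemma abs_psi_exponent_le: "\<bar>psi_exponent p\<bar> \<le> B / (1 - b)"
proof (cases "fst p \<in> {0..1}")
  case True
  hence "fst p powr b \<le> 1" using b_pos by (intro powr_le1) auto
  hence "fst p powr b * \<bar>K (snd p)\<bar> \<le> 1 * B"
    using K_bound by (intro mult_mono) auto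
  thus ?thesis using True b_less
    by (simp add: psi_exponent_def abs_mult divide_right_mono)
next
  case False
  thus ?thesis using B_nonneg b_less by (auto simp: psi_exponent_def)
qed

text \<open>The singular weight \<open>s powr (- b)\<close> cancels against the power
  \<open>s powr b\<close> in the exponent, leaving the indicator of the unit interval times
  \<open>\<bar>K z\<bar> / (1 - b)\<close> as a majorant. This is the product that differentiation
  under the integral requires.\<close>

lemma psi_integrable: "integrable lborel (\<lambda>p. psi_weight p * psi_exponent p)"
proof (rule Bochner_Integration.integrable_bound)
  show "integrable lborel (\<lambda>p :: real \<times> 'a. indicator {0..1} (fst p) * (\<bar>K (snd p)\<bar> / (1 - b)))"
    unfolding lborel_prod[symmetric]
  proof (rule lborel_pair.Fubini_integrable)
    show "integrable lborel (\<lambda>s::real. LINT z|lborel. norm (indicator {0..1} (fst (s, z)) * (\<bar>K (snd (s, z))\<bar> / (1 - b))))"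
      using b_less by (simp add: abs_mult)
    show "AE s::real in lborel. integrable lborel (\<lambda>z. indicator {0..1} (fst (s, z)) * (\<bar>K (snd (s, z))\<bar> / (1 - b)))"
      using K_integrable by simp
  qed simp
  show "AE p in lborel. norm (psi_weight p * psi_exponent p)
     \<le> norm (indicator {0..1} (fst p) * (\<bar>K (snd p)\<bar> / (1 - b)))"
  proof (rule AE_I2)
    fix p :: "real \<times> 'a"
    \<comment> \<open>Not an equality: at 0 both powers are 0 by convention.\<close>
    have "fst p powr (- b) * fst p powr b \<le> 1"
      by (cases "fst p = 0") (simp_all add: powr_minus)
    hence "(fst p powr (- b) * fst p powr b) * (\<bar>K (snd p)\<bar> / (1 - b)) \<le> 1 * (\<bar>K (snd p)\<bar> / (1 - b))"
      using b_less by (intro mult_right_mono) auto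
    thus "norm (psi_weight p * psi_exponent p)
        \<le> norm (indicator {0..1} (fst p) * (\<bar>K (snd p)\<bar> / (1 - b)))"
      using b_less by (simp add: psi_weight_def psi_exponent_def abs_mult indicator_def mult_ac)
  qed
qed simp

lemma kde_psi_deriv:
  "(kde_psi a K has_real_derivative (LINT p|lborel. psi_weight p * psi_exponent p * exp (u * psi_exponent p))) (at u)"
  using has_derivative_integral_exp_minus_one[OF _ _ psi_integrable abs_psi_exponent_le, of u]
  by (simp add: kde_psi_eq_exp_integral[abs_def])

lemma limit_cgf_measurable [measurable]: "limit_cgf \<in> borel_measurable borel"
  unfolding limit_cgf_def[abs_def] by measurable

text \<open>By Fubini the inner integral over \<open>z\<close> is \<open>limit_cgf\<close>, which is
  the form in which the limit of the averages appears.\<close>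

lemma kde_psi_eq_iterated:
  "kde_psi a K u = (LINT s:{0<..1}|lborel. s powr (- b) * limit_cgf (u * (1 / (1 - b)) * s powr b))"
proof -
  have "integrable (lborel \<Otimes>\<^sub>M lborel) (\<lambda>p. psi_weight p * (exp (u * psi_exponent p) - 1))"
    unfolding lborel_prod
    by (rule integrable_exp_minus_one[OF _ _ psi_integrable abs_psi_exponent_le]) simp_all
  hence "kde_psi a K u
      = (LINT s|lborel. LINT z|lborel. psi_weight (s, z) * (exp (u * psi_exponent (s, z)) - 1))"
    unfolding kde_psi_eq_exp_integral lborel_prod[symmetric]
    by (rule lborel_pair.integral_fst'[symmetric])
  also have "\<dots> = (LINT s:{0<..1}|lborel. s powr (- b) * limit_cgf (u * (1 / (1 - b)) * s powr b))"
    unfolding set_lebesgue_integral_def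
  proof (intro Bochner_Integration.integral_cong refl)
    fix s :: real
    \<comment> \<open>The point 0 is separate: it belongs to the closed interval in
      \<open>psi_weight\<close>, but the weight \<open>0 powr (- b)\<close> is 0 there.\<close>
    consider "s \<in> {0<..1}" | "s = 0" | "s \<notin> {0..1}" by force
    thus "(LINT z|lborel. psi_weight (s, z) * (exp (u * psi_exponent (s, z)) - 1))
      = indicator {0<..1} s *\<^sub>R (s powr (- b) * limit_cgf (u * (1 / (1 - b)) * s powr b))"
      by cases (auto simp: psi_weight_def psi_exponent_def limit_cgf_def mult_ac)
  qed
  finally show ?thesis .
qed

section \<open>Convergence of the scaled cumulant generating function\<close>

lemma estimator_cgf_tendsto:
  "(\<lambda>n. ln (expectation (\<lambda>\<omega>. exp (speed n * u * (rec_kde h K X n x \<omega> - f x)))) / speed n)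
     \<longlonglongrightarrow> f x * (1 - b) * kde_psi a K u - u * f x"
proof -
  have avg: "powr_average b \<longlonglongrightarrow> 1 / (1 - b)" using b_pos b_less by (rule powr_average_tendsto)
  hence "Bseq (powr_average b)" using convergentI convergent_imp_Bseq by blast
  then obtain A where A: "\<And>n. \<bar>powr_average b n\<bar> \<le> A" by (auto simp: Bseq_def)
  have "A \<ge> 0" using A[of 0] by linarith
  \<comment> \<open>Bounds all tilts with \<open>1 \<le> i \<le> n\<close>, since then
    \<open>(real i / real n) powr b \<le> 1\<close>.\<close>
  define T where "T = \<bar>u\<bar> * A"
  define C where "C = exp (T * B) * (F\<^sub>0 * exp (T * B) * (LINT z|lborel. \<bar>K z\<bar>))"
  have "C \<ge> 0" using F0_nonneg by (simp add: C_def)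
  have "(\<lambda>n. (\<Sum>i=1..n. (real i / real n) powr (- b) * local_cgf (h i) (tilt u n i)) / real n)
    \<longlonglongrightarrow> (LINT s:{0<..1}|lborel. s powr (- b) * (f x * limit_cgf (u * (1 / (1 - b)) * s powr b)))"
  proof (rule average_tendsto_integral)
    \<comment> \<open>A constant majorant suffices: \<open>local_cgf\<close> is at most
      \<open>C\<close> times the tilt, and the tilt at ratio \<open>r\<close> is at most
      \<open>T * r powr b\<close>, which absorbs \<open>r powr (- b)\<close>.\<close>
    show "set_integrable lborel {0<..1} (\<lambda>_::real. C * T)"
      unfolding set_integrable_def by simp
    fix s :: real assume s: "0 < s" "s \<le> 1"
    let ?i = "\<lambda>n. nat \<lceil>real n * s\<rceil>"
    have i_top: "filterlim ?i at_top sequentially" using s(1) by (rule ceiling_scaled_at_top)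
    have ratio: "(\<lambda>n. real (?i n) / real n) \<longlonglongrightarrow> s" using s(1) by (rule ceiling_scaled_tendsto)
    have "(\<lambda>n. local_cgf (h (?i n)) (tilt u n (?i n))) \<longlonglongrightarrow> f x * limit_cgf (u * (1 / (1 - b)) * s powr b)"
    proof (rule local_cgf_tendsto)
      show "(\<lambda>n. h (?i n)) \<longlonglongrightarrow> 0" using h_tendsto i_top by (rule filterlim_compose)
      show "(\<lambda>n. tilt u n (?i n)) \<longlonglongrightarrow> u * (1 / (1 - b)) * s powr b"
        unfolding tilt_def using s by (intro tendsto_intros avg ratio) simp
      have "eventually (\<lambda>n. ?i n \<ge> 1) sequentially" using i_top by (simp add: filterlim_at_top)
      thus "eventually (\<lambda>n. h (?i n) > 0) sequentially" by eventually_elim (rule h_pos)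
    qed
    thus "(\<lambda>n. (real (?i n) / real n) powr (- b) * local_cgf (h (?i n)) (tilt u n (?i n)))
       \<longlonglongrightarrow> s powr (- b) * (f x * limit_cgf (u * (1 / (1 - b)) * s powr b))"
      using s by (intro tendsto_intros ratio) auto
    fix n :: nat assume n: "n \<ge> 1"
    define r where "r = real (?i n) / real n"
    have "real n * s > 0" using s n by simp
    hence i1: "?i n \<ge> 1" by linarith
    have "real n * s \<le> real n" using s n by simp
    hence "?i n \<le> n" by linarith
    moreover have "real (?i n) > 0" using i1 by linarith
    ultimately have r: "0 < r" "r \<le> 1" using n by (auto simp: r_def simp del: nat_ceiling_le_eq)
    have tilt_le: "\<bar>tilt u n (?i n)\<bar> \<le> T * r powr b"
      unfolding tilt_def r_def[symmetric] T_def abs_mult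
      using A[of n] by (auto intro!: mult_right_mono mult_left_mono)
    moreover have "r powr b \<le> 1" using r b_pos by (intro powr_le1) auto
    ultimately have "\<bar>tilt u n (?i n)\<bar> \<le> T"
      using \<open>A \<ge> 0\<close> mult_left_mono[of "r powr b" 1 T] by (simp add: T_def)
    hence "\<bar>local_cgf (h (?i n)) (tilt u n (?i n))\<bar> \<le> C * \<bar>tilt u n (?i n)\<bar>"
      unfolding C_def by (intro abs_local_cgf_le h_pos i1)
    also have "\<dots> \<le> C * (T * r powr b)" using tilt_le \<open>C \<ge> 0\<close> by (rule mult_left_mono)
    finally have "r powr (- b) * \<bar>local_cgf (h (?i n)) (tilt u n (?i n))\<bar> \<le> r powr (- b) * (C * (T * r powr b))"
      by (rule mult_left_mono) simp
    also have "\<dots> = C * T" using r by (simp add: powr_minus field_simps)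
    finally show "\<bar>(real (?i n) / real n) powr (- b) * local_cgf (h (?i n)) (tilt u n (?i n))\<bar> \<le> C * T"
      by (simp add: abs_mult r_def)
  qed simp
  also have "(LINT s:{0<..1}|lborel. s powr (- b) * (f x * limit_cgf (u * (1 / (1 - b)) * s powr b)))
     = f x * kde_psi a K u"
    by (simp add: kde_psi_eq_iterated mult.left_commute)
  finally have "(\<lambda>n. (\<Sum>i=1..n. (real i / real n) powr (- b) * local_cgf (h i) (tilt u n i)) / real n
      / powr_average b n - u * f x) \<longlonglongrightarrow> f x * kde_psi a K u / (1 / (1 - b)) - u * f x"
    using avg b_less by (intro tendsto_intros) auto
  moreover have "eventually (\<lambda>n. (\<Sum>i=1..n. (real i / real n) powr (- b) * local_cgf (h i) (tilt u n i)) / real n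
      / powr_average b n - u * f x
      = ln (expectation (\<lambda>\<omega>. exp (speed n * u * (rec_kde h K X n x \<omega> - f x)))) / speed n) sequentially"
    using eventually_ge_at_top[of 1] by eventually_elim (simp add: estimator_cgf)
  ultimately have "(\<lambda>n. ln (expectation (\<lambda>\<omega>. exp (speed n * u * (rec_kde h K X n x \<omega> - f x)))) / speed n)
      \<longlonglongrightarrow> f x * kde_psi a K u / (1 / (1 - b)) - u * f x"
    by (rule Lim_transform_eventually)
  thus ?thesis by (simp add: mult_ac)
qed

text \<open>For positive density, \<open>m = f x * (1 - b)\<close> can be pulled through the
  supremum, and \<open>m * (1 / (1 - b) + t / m) = f x + t\<close> matches the linear terms. For
  zero density the transformed function vanishes identically, and its conjugate is 0 at 0 and
  infinite elsewhere.\<close>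

lemma legendre_eq_rate:
  "legendre (\<lambda>u. f x * (1 - b) * kde_psi a K u - u * f x) = kde_Ix a K f x"
proof
  fix t
  show "legendre (\<lambda>u. f x * (1 - b) * kde_psi a K u - u * f x) t = kde_Ix a K f x t"
  proof (cases "f x = 0")
    case True
    show ?thesis
    proof (cases "t = 0")
      case False
      have "(SUP u\<in>UNIV. ereal (u * t)) = \<infinity>"
      proof (rule SUP_PInfty)
        fix n :: nat
        show "\<exists>u\<in>UNIV. ereal (real n) \<le> ereal (u * t)"
          using False by (intro bexI[of _ "real n / t"]) auto
      qed
      thus ?thesis using True False by (simp add: legendre_def kde_Ix_def)
    qed (use True in \<open>simp add: legendre_def kde_Ix_def zero_ereal_def\<close>)
  next
    case False
    define m where "m = f x * (1 - b)"
    have "m > 0" using False f_nonneg[of x] b_less by (simp add: m_def)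
    have "ereal m * kde_I a K (1 / (1 - b) + t / m)
        = (SUP u\<in>UNIV. ereal m * ereal (u * (1 / (1 - b) + t / m) - kde_psi a K u))"
      unfolding kde_I_def using \<open>m > 0\<close> by (intro Sup_ereal_mult_left') auto
    also have "\<dots> = (SUP u\<in>UNIV. ereal (u * t - (m * kde_psi a K u - u * f x)))"
    proof (intro SUP_cong refl)
      fix u
      have "m * (1 / (1 - b) + t / m) = f x + t"
        using b_less \<open>m > 0\<close> False by (simp add: m_def distrib_left)
      hence "m * (u * (1 / (1 - b) + t / m) - kde_psi a K u) = u * (f x + t) - m * kde_psi a K u"
        by (metis mult.left_commute right_diff_distrib)
      thus "ereal m * ereal (u * (1 / (1 - b) + t / m) - kde_psi a K u)
          = ereal (u * t - (m * kde_psi a K u - u * f x))"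
        by (simp add: distrib_left)
    qed
    finally show ?thesis
      using False by (simp add: legendre_def kde_Ix_def m_def b_def)
  qed
qed

theorem estimator_LDP:
  "LDP M (\<lambda>n \<omega>. rec_kde h K X n x \<omega> - f x) speed (kde_Ix a K f x)"
proof -
  interpret G: scaled_cgf_limit M "\<lambda>n \<omega>. rec_kde h K X n x \<omega> - f x" speed
    "\<lambda>u. f x * (1 - b) * kde_psi a K u - u * f x"
    "\<lambda>u. f x * (1 - b) * (LINT p|lborel. psi_weight p * psi_exponent p * exp (u * psi_exponent p)) - f x"
  proof
    fix u
    show "((\<lambda>u. f x * (1 - b) * kde_psi a K u - u * f x) has_real_derivative
      f x * (1 - b) * (LINT p|lborel. psi_weight p * psi_exponent p * exp (u * psi_exponent p)) - f x) (at u)"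
      by (auto intro!: derivative_eq_intros kde_psi_deriv)
  qed (use speed_at_top estimator_mgf_integrable estimator_cgf_tendsto in simp_all)
  have "speed n \<le> speed (Suc n)" for n
    using h_pos[of "Suc n"] by (simp add: speed_def)
  thus ?thesis
    using G.gaertner_ellis speed_pos by (simp add: legendre_eq_rate)
qed

end

theorem theorem1:
  fixes M :: "'b measure"
    and X :: "nat \<Rightarrow> 'b \<Rightarrow> 'a::euclidean_space"
    and f :: "'a \<Rightarrow> real"
    and K :: "'a \<Rightarrow> real"
    and h :: "nat \<Rightarrow> real"
    and c a :: real
    and x :: 'a
  assumes "prob_space M"
    and "prob_space.indep_vars M (\<lambda>_. borel) X {1..}"
    and "\<And>i. i \<ge> 1 \<Longrightarrow> distributed M lborel (X i) (\<lambda>y. ennreal (f y))"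
    and "\<And>y. f y \<ge> 0"
    and "bounded (range f)"
    \<comment> \<open>(H1)\<close>
    and "bounded (range K)"
    and "integrable lborel K"
    and "integral\<^sup>L lborel K = 1"
    and "(K \<longlongrightarrow> 0) at_infinity"
    \<comment> \<open>(H2)\<close>
    and "c > 0" and "0 < a" and "a < 1 / real DIM('a)"
    and "\<And>n. n \<ge> 1 \<Longrightarrow> h n = c * real n powr (- a)"
    \<comment> \<open>continuity of f at x\<close>
    and "isCont f x"
  shows "LDP M (\<lambda>n \<omega>. rec_kde h K X n x \<omega> - f x)
             (\<lambda>n. \<Sum>i=1..n. h i ^ DIM('a)) (kde_Ix a K f x)"
proof -
  obtain F\<^sub>0 where F: "\<And>y. \<bar>f y\<bar> \<le> F\<^sub>0" using assms(5) by (auto simp: bounded_iff)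
  obtain B where B: "\<And>z. \<bar>K z\<bar> \<le> B" using assms(6) by (auto simp: bounded_iff)
  interpret prob_space M by fact
  interpret recursive_kernel_estimator M X f K h c a x F\<^sub>0 B
    by unfold_locales (use assms F B in \<open>auto simp: abs_le_iff\<close>)
  show ?thesis using estimator_LDP unfolding speed_def[abs_def] .
qed

end
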